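(* For every $\varepsilon>0$, \[ \bigl|\{ t\in\mathbb{Z},\ 0\le t\leq T : 1/2 - \varepsilon < \tilde c_t < 1/2 < c_t < 1/2 + \varepsilon\}\bigr| = T + O\!\left( \frac T{\log T} \right) \] as $T\to\infty$. In particular, $\tilde c_t < 1/2 < c_t$ holds for all $t$ in a subset of $\mathbb{N}$ of asymptotic density $1$.
   Context: For a nonnegative integer $n$, $s(n)$ denotes the binary sum of digits of $n$ (the number of digits $1$ in the base-$2$ expansion of $n$). For an integer $t\ge 0$, $c_t$ is the asymptotic density of the set $\{n\ge 0: s(n+t)\ge s(n)\}$ and $\tilde c_t$ is the asymptotic density of $\{n\ge 0: s(n+t)> s(n)\}$ (these densities exist, since the defining conditions are periodic in $n$). *)

theory Defs
  imports Complex_Main "HOL-Library.Landau_Symbols"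
begin

fun bsum :: "nat \<Rightarrow> nat" where
  "bsum n = (if n = 0 then 0 else n mod 2 + bsum (n div 2))"

declare bsum.simps [simp del]

definition adensity :: "nat set \<Rightarrow> real" where
  "adensity A = lim (\<lambda>N. real (card {n \<in> A. n < N}) / real N)"

definition c :: "nat \<Rightarrow> real" where
  "c t = adensity {n. bsum (n + t) \<ge> bsum n}"

definition ct :: "nat \<Rightarrow> real" where
  "ct t = adensity {n. bsum (n + t) > bsum n}"

end

(*
  Let X be the random variable s(n+t) - s(n), with n uniformly distributed. Then
  c t - ct t = P(X = 0) and c t + ct t - 1 = P(X > 0) - P(X < 0), so ct t < 1/2 < c t says that
  |P(X > 0) - P(X < 0)| < P(X = 0). Both quantities are integrals over the characteristic
  function gam x t of X: of its real part, and of its imaginary part times cot (x/2).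

  For t uniform in [0, 2^n) the pair (gam x t, gam x (t+1)) is a product of n independent random
  2x2 matrices, so the averages over t of its quadratic monomials satisfy linear recurrences.
  With k = 1 - cos x and r = 1 - k/20, these give mean squares over t of order n k^2 r^n for
  Re gam - (1 - k/2)^n and n k^3 r^n for Im gam. After integration over x both
  P(X = 0) - g(n) and P(X > 0) - P(X < 0) have mean square O(1/n^2), where g(n) is of exact order
  1/sqrt n, and Chebyshev's inequality leaves O(2^n/n) exceptional t < 2^n.
*)

theory Submission
  imports Defs "HOL-Analysis.Analysis" "HOL-Real_Asymp.Real_Asymp"
begin

section \<open>Densities\<close>

text \<open>The powers of k decide whether Chebyshev's inequality says anything. A bound n k^2 r^n
  is at most a constant times (1/n) / (1 + n k)^2, and since k is of order x^2 on [0, pi], the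
  square root of this integrates to order 1/n, which is smaller than g(n) by a factor 1/sqrt n. The
  square of cot (x/2) is of order 1/k at 0, so Im gam has to be smaller than Re gam - (1 - k/2)^n by
  a further factor k in mean square. With k^2 in place of k^3, the deviation would be of the order
  of g(n) itself. Estimates of gam as a complex number cannot see this, because its real part is
  close to 1 near x = 0; hence the separate system of moments for the imaginary parts.

  The main term g(n) is the integral of (1 - k/2)^n, because 1 - k/2 is the factor by which one
  digit multiplies the mean of Re (gam x t) and Re (gam x (t+1)), up to small terms.

  The integral formulas are obtained without Fourier inversion: both sides obey the same recursion
  over the digits of t, and its solution is unique under a growth condition.\<close>

definition has_density :: "nat set \<Rightarrow> real \<Rightarrow> bool" where
  "has_density A d \<longleftrightarrow> (\<lambda>N. real (card {n \<in> A. n < N}) / real N) \<longlonglongrightarrow> d"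

text \<open>\<open>lim\<close> is unspecified on divergent sequences. Convergence is therefore
  proved first, and values of \<open>adensity\<close> are obtained only through this lemma.\<close>

lemma has_density_adensity: "has_density A d \<Longrightarrow> adensity A = d"
  unfolding has_density_def adensity_def by (rule limI)

lemma card_even_odd_split:
  fixes A :: "nat set"
  shows "card {n \<in> A. n < N} =
     card {m \<in> {m. 2 * m \<in> A}. m < (N + 1) div 2} + card {m \<in> {m. 2 * m + 1 \<in> A}. m < N div 2}"
proof -
  let ?E = "{m \<in> {m. 2 * m \<in> A}. m < (N + 1) div 2}"
  let ?O = "{m \<in> {m. 2 * m + 1 \<in> A}. m < N div 2}"
  have split: "{n \<in> A. n < N} = (\<lambda>m. 2 * m) ` ?E \<union> (\<lambda>m. 2 * m + 1) ` ?O" (is "_ = ?R")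
  proof
    show "{n \<in> A. n < N} \<subseteq> ?R"
    proof
      fix n assume n: "n \<in> {n \<in> A. n < N}"
      show "n \<in> ?R"
      proof (cases "even n")
        case True
        then obtain m where "n = 2 * m" by blast
        with n have "m \<in> ?E" by auto
        with \<open>n = 2 * m\<close> show ?thesis by blast
      next
        case False
        then obtain m where "n = 2 * m + 1" by (rule oddE)
        with n have "m \<in> ?O" by auto
        with \<open>n = 2 * m + 1\<close> show ?thesis by blast
      qed
    qed
    have "2 * m < N" if "m < (N + 1) div 2" for m using that by presburger
    moreover have "2 * m + 1 < N" if "m < N div 2" for m using that by presburger
    ultimately show "?R \<subseteq> {n \<in> A. n < N}"
      by (intro Un_least image_subsetI; simp only: mem_Collect_eq; blast)
  qed
  have "card ?R = card ((\<lambda>m. 2 * m) ` ?E) + card ((\<lambda>m. 2 * m + 1) ` ?O)"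
  proof (rule card_Un_disjoint)
    have neq: "2 * m \<noteq> 2 * m' + 1" for m m' :: nat by presburger
    show "(\<lambda>m. 2 * m) ` ?E \<inter> (\<lambda>m. 2 * m + 1) ` ?O = {}"
      by (intro equals0I, elim IntE imageE, simp only: neq)
    have "?E \<subseteq> {..<(N + 1) div 2}" "?O \<subseteq> {..<N div 2}" by blast+
    then have fin: "finite ?E" "finite ?O" using finite_subset finite_lessThan by blast+
    show "finite ((\<lambda>m. 2 * m) ` ?E)" by (rule finite_imageI[OF fin(1)])
    show "finite ((\<lambda>m. 2 * m + 1) ` ?O)" by (rule finite_imageI[OF fin(2)])
  qed
  also have "card ((\<lambda>m. 2 * m) ` ?E) = card ?E"
    by (rule card_image, rule inj_onI) linarith
  also have "card ((\<lambda>m. 2 * m + 1) ` ?O) = card ?O"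
    by (rule card_image, rule inj_onI) linarith
  finally show ?thesis by (simp only: split)
qed

lemma half_ratio_tendsto:
  "(\<lambda>N. real (N div 2) / real N) \<longlonglongrightarrow> 1/2" "(\<lambda>N. real ((N + 1) div 2) / real N) \<longlonglongrightarrow> 1/2"
proof -
  have lower: "(\<lambda>N. 1/2 - 1 / real N) \<longlonglongrightarrow> 1/2"
    using tendsto_diff[OF tendsto_const lim_1_over_n, of "1/2 :: real"] by simp
  have upper: "(\<lambda>N. 1/2 + 1 / real N) \<longlonglongrightarrow> 1/2"
    using tendsto_add[OF tendsto_const lim_1_over_n, of "1/2 :: real"] by simp
  have lim: "(\<lambda>N. real (f N) / real N) \<longlonglongrightarrow> 1/2"
    if f: "\<And>N. real N - 2 \<le> 2 * real (f N)" "\<And>N. 2 * real (f N) \<le> real N + 2" for f :: "nat \<Rightarrow> nat"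
  proof (rule tendsto_sandwich[OF _ _ lower upper])
    have "1/2 - 1 / real N \<le> real (f N) / real N \<and> real (f N) / real N \<le> 1/2 + 1 / real N"
      if "0 < N" for N
    proof -
      have "1/2 - 1 / real N = (real N - 2) / (2 * real N)" "1/2 + 1 / real N = (real N + 2) / (2 * real N)"
        "real (f N) / real N = (2 * real (f N)) / (2 * real N)"
        using that by (simp_all add: field_simps)
      moreover have "(real N - 2) / (2 * real N) \<le> (2 * real (f N)) / (2 * real N)"
        "(2 * real (f N)) / (2 * real N) \<le> (real N + 2) / (2 * real N)"
        by (intro divide_right_mono f; simp)+
      ultimately show ?thesis by metis
    qed
    then show "\<forall>\<^sub>F N in sequentially. 1/2 - 1 / real N \<le> real (f N) / real N"
      "\<forall>\<^sub>F N in sequentially. real (f N) / real N \<le> 1/2 + 1 / real N"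
      by (auto intro!: eventually_mono[OF eventually_gt_at_top[of 0]])
  qed
  show "(\<lambda>N. real (N div 2) / real N) \<longlonglongrightarrow> 1/2" "(\<lambda>N. real ((N + 1) div 2) / real N) \<longlonglongrightarrow> 1/2"
    by (rule lim; linarith)+
qed

lemma has_density_even_odd:
  assumes "has_density {m. 2 * m \<in> A} d" "has_density {m. 2 * m + 1 \<in> A} d'"
  shows "has_density A ((d + d') / 2)"
proof -
  let ?e = "\<lambda>N. real (card {m \<in> {m. 2 * m \<in> A}. m < N})"
  let ?o = "\<lambda>N. real (card {m \<in> {m. 2 * m + 1 \<in> A}. m < N})"
  have lim_e: "filterlim (\<lambda>N::nat. (N + 1) div 2) at_top sequentially"
    unfolding filterlim_at_top
  proof
    fix Z :: nat
    show "\<forall>\<^sub>F N in sequentially. Z \<le> (N + 1) div 2"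
      by (rule eventually_sequentiallyI[of "2 * Z"]) simp
  qed
  have lim_o: "filterlim (\<lambda>N::nat. N div 2) at_top sequentially"
    unfolding filterlim_at_top
  proof
    fix Z :: nat
    show "\<forall>\<^sub>F N in sequentially. Z \<le> N div 2"
      by (rule eventually_sequentiallyI[of "2 * Z"]) simp
  qed
  have "(\<lambda>N. ?e ((N + 1) div 2) / real ((N + 1) div 2) * (real ((N + 1) div 2) / real N)
          + ?o (N div 2) / real (N div 2) * (real (N div 2) / real N)) \<longlonglongrightarrow> d * (1/2) + d' * (1/2)"
    by (intro tendsto_add tendsto_mult half_ratio_tendsto
        filterlim_compose[OF assms(1)[unfolded has_density_def] lim_e]
        filterlim_compose[OF assms(2)[unfolded has_density_def] lim_o])
  moreover have "?e ((N + 1) div 2) / real ((N + 1) div 2) * (real ((N + 1) div 2) / real N)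
          + ?o (N div 2) / real (N div 2) * (real (N div 2) / real N)
        = real (card {n \<in> A. n < N}) / real N" for N
  proof -
    \<comment> \<open>For \<open>N \<le> 1\<close> a denominator is 0 and the quotient has the
      default value 0. This is harmless because both counting functions vanish at 0.\<close>
    have cancel: "x n / real n * (real n / real N) = x n / real N" if "x 0 = 0" for x :: "nat \<Rightarrow> real" and n
      using that by (cases "n = 0") simp_all
    have "?e ((N + 1) div 2) / real ((N + 1) div 2) * (real ((N + 1) div 2) / real N)
        = ?e ((N + 1) div 2) / real N" "?o (N div 2) / real (N div 2) * (real (N div 2) / real N)
        = ?o (N div 2) / real N"
      using cancel[of ?e] cancel[of ?o] by simp_all
    then show ?thesis
      unfolding card_even_odd_split[of A N] by (simp only: of_nat_add add_divide_distrib)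
  qed
  ultimately show ?thesis
    unfolding has_density_def by (simp add: add_divide_distrib)
qed

lemma has_density_empty: "has_density {} 0"
  by (simp add: has_density_def)

lemma has_density_UNIV: "has_density UNIV 1"
proof -
  have "\<forall>\<^sub>F N in sequentially. real (card {n \<in> UNIV :: nat set. n < N}) / real N = 1"
    by (rule eventually_mono[OF eventually_gt_at_top[of 0]]) auto
  then show ?thesis
    unfolding has_density_def by (rule tendsto_eventually)
qed

section \<open>Digit sums and the recursion for the densities of the gain s(n+t) - s(n)\<close>

lemma nat_binary_cases:
  fixes t :: nat
  obtains "t = 0" | "t = 1" | u where "t = 2 * u" "u < t" | u where "t = 2 * u + 1" "u + 1 < t" "u < t"
proof -
  have "t = 0 \<or> t = 1 \<or> (\<exists>u. t = 2 * u \<and> u < t) \<or> (\<exists>u. t = 2 * u + 1 \<and> u + 1 < t \<and> u < t)"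
    by presburger
  then show ?thesis by (elim disjE exE conjE) (fact that)+
qed

lemma bsum_double: "bsum (2 * n) = bsum n"
  by (cases "n = 0") (simp_all add: bsum.simps[of "2 * n"])

lemma bsum_double_Suc: "bsum (Suc (2 * n)) = Suc (bsum n)"
  by (simp add: bsum.simps[of "Suc (2 * n)"])

lemma bsum_Suc_le: "bsum (Suc n) \<le> Suc (bsum n)"
proof (induction n rule: less_induct)
  case (less n)
  show ?case
  proof (cases "even n")
    case True
    then obtain m where "n = 2 * m" by blast
    then show ?thesis by (simp add: bsum_double bsum_double_Suc)
  next
    case False
    then obtain m where m: "n = 2 * m + 1" by (rule oddE)
    have "bsum (Suc n) = bsum (Suc m)"
      using bsum_double[of "Suc m"] m by simp
    also have "\<dots> \<le> Suc (bsum m)" using less m by simp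
    finally show ?thesis using m by (simp add: bsum_double_Suc)
  qed
qed

text \<open>An odd shift moves the threshold by one in both directions, so the thresholds 0 and 1 of
  \<open>c\<close> and \<open>ct\<close> cannot be treated alone and \<open>k\<close> ranges over
  all integers.\<close>

definition gain_ge :: "int \<Rightarrow> nat \<Rightarrow> nat set" where
  "gain_ge k t = {n. int (bsum (n + t)) - int (bsum n) \<ge> k}"

definition gain_tail :: "int \<Rightarrow> nat \<Rightarrow> real" where
  "gain_tail k t = adensity (gain_ge k t)"

text \<open>A carry out of the lowest digit occurs only if both summands are odd. The digit 1 of n
  is then lost, which raises the threshold, and the carry turns the remaining shift into
  \<open>t + 1\<close>.\<close>

lemma gain_ge_split:
  "{m. 2 * m \<in> gain_ge k (2 * t)} = gain_ge k t"
  "{m. 2 * m + 1 \<in> gain_ge k (2 * t)} = gain_ge k t"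
  "{m. 2 * m \<in> gain_ge k (2 * t + 1)} = gain_ge (k - 1) t"
  "{m. 2 * m + 1 \<in> gain_ge k (2 * t + 1)} = gain_ge (k + 1) (t + 1)"
proof -
  have e: "2 * m + 2 * t = 2 * (m + t)" "2 * m + 1 + 2 * t = Suc (2 * (m + t))"
    "2 * m + (2 * t + 1) = Suc (2 * (m + t))" "2 * m + 1 + (2 * t + 1) = 2 * (m + (t + 1))"
    "2 * m + 1 = Suc (2 * m)" for m
    by simp_all
  show "{m. 2 * m \<in> gain_ge k (2 * t)} = gain_ge k t"
    unfolding gain_ge_def mem_Collect_eq e bsum_double bsum_double_Suc by auto
  show "{m. 2 * m + 1 \<in> gain_ge k (2 * t)} = gain_ge k t"
    unfolding gain_ge_def mem_Collect_eq e(2) unfolding e(5) bsum_double bsum_double_Suc by auto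
  show "{m. 2 * m \<in> gain_ge k (2 * t + 1)} = gain_ge (k - 1) t"
    unfolding gain_ge_def mem_Collect_eq e(3) bsum_double bsum_double_Suc by auto
  show "{m. 2 * m + 1 \<in> gain_ge k (2 * t + 1)} = gain_ge (k + 1) (t + 1)"
    unfolding gain_ge_def mem_Collect_eq e(4) unfolding e(5) bsum_double bsum_double_Suc by auto
qed

lemma gain_ge_0: "gain_ge k 0 = (if k \<le> 0 then UNIV else {})"
  by (auto simp: gain_ge_def)

lemma gain_ge_1_empty:
  assumes "k \<ge> 2" shows "gain_ge k 1 = {}"
proof -
  have "int (bsum (n + 1)) - int (bsum n) \<le> 1" for n
    using bsum_Suc_le[of n] by simp
  then show ?thesis
    using assms unfolding gain_ge_def by (metis (mono_tags, lifting) Collect_empty_eq dual_order.trans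
      numeral_le_one_iff of_nat_numeral of_nat_1 one_le_numeral not_numeral_le_zero semiring_norm(69))
qed

lemma has_density_gain_ge_even_odd:
  "has_density (gain_ge k t) d \<Longrightarrow> has_density (gain_ge k (2 * t)) d"
  "\<lbrakk>has_density (gain_ge (k - 1) t) d; has_density (gain_ge (k + 1) (t + 1)) d'\<rbrakk>
     \<Longrightarrow> has_density (gain_ge k (2 * t + 1)) ((d + d') / 2)"
  using has_density_even_odd[of "gain_ge k (2 * t)" d d]
    has_density_even_odd[of "gain_ge k (2 * t + 1)" d d']
  unfolding gain_ge_split by simp_all

lemma has_density_gain_ge_0: "has_density (gain_ge k 0) (if k \<le> 0 then 1 else 0)"
  by (simp add: gain_ge_0 has_density_empty has_density_UNIV)

text \<open>For \<open>1 = 2 * 0 + 1\<close> the odd rule at threshold \<open>k - 1\<close> needs t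
  = 1 again, but at the larger threshold \<open>k\<close>. Hence a descending induction on
  \<open>k\<close> from 2, where the set is empty.\<close>

lemma ex_has_density_gain_ge_1: "\<exists>d. has_density (gain_ge k 1) d"
proof (cases "k \<le> 2")
  case True
  then show ?thesis
  proof (induction k rule: int_le_induct)
    case base
    show ?case using has_density_empty gain_ge_1_empty[of 2] by auto
  next
    case (step k)
    then obtain d where "has_density (gain_ge k 1) d" by blast
    from has_density_gain_ge_even_odd(2)[of "k - 1" 0, OF has_density_gain_ge_0, of d] this
    show ?case by auto
  qed
next
  case False
  then show ?thesis using has_density_empty gain_ge_1_empty[of k] by auto
qed

lemma ex_has_density_gain_ge: "\<exists>d. has_density (gain_ge k t) d"
proof (induction t arbitrary: k rule: less_induct)
  case (less t)
  consider "t = 0" | "t = 1" | u where "t = 2 * u" "u < t" | u where "t = 2 * u + 1" "u + 1 < t" "u < t"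
    by (rule nat_binary_cases)
  then show ?case
  proof cases
    case 1 then show ?thesis using has_density_gain_ge_0 by blast
  next
    case 2 then show ?thesis using ex_has_density_gain_ge_1 by blast
  next
    case (3 u) then show ?thesis using less has_density_gain_ge_even_odd(1) by blast
  next
    case (4 u) then show ?thesis using less has_density_gain_ge_even_odd(2) by blast
  qed
qed

lemma has_density_gain_tail: "has_density (gain_ge k t) (gain_tail k t)"
  using ex_has_density_gain_ge[of k t] has_density_adensity unfolding gain_tail_def by blast

lemma gain_tail_eqI: "has_density (gain_ge k t) d \<Longrightarrow> gain_tail k t = d"
  unfolding gain_tail_def by (rule has_density_adensity)

lemma gain_tail_0: "gain_tail k 0 = (if k \<le> 0 then 1 else 0)"
  by (rule gain_tail_eqI[OF has_density_gain_ge_0])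

lemma gain_tail_even: "gain_tail k (2 * t) = gain_tail k t"
  by (intro gain_tail_eqI has_density_gain_ge_even_odd has_density_gain_tail)

lemma gain_tail_odd:
  "gain_tail k (2 * t + 1) = (gain_tail (k - 1) t + gain_tail (k + 1) (t + 1)) / 2"
  by (intro gain_tail_eqI has_density_gain_ge_even_odd has_density_gain_tail)

lemma gain_tail_bounds: "0 \<le> gain_tail k t" "gain_tail k t \<le> 1"
proof -
  note lim = has_density_gain_tail[of k t, unfolded has_density_def]
  show "0 \<le> gain_tail k t"
    by (rule LIMSEQ_le_const[OF lim]) auto
  have "card {n \<in> gain_ge k t. n < N} \<le> N" for N
    using card_mono[of "{..<N}" "{n \<in> gain_ge k t. n < N}"] by auto
  then show "gain_tail k t \<le> 1"
    by (intro LIMSEQ_le_const2[OF lim] exI[of _ 1]) (auto simp: divide_le_eq)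
qed

lemma c_eq_gain_tail: "c t = gain_tail 0 t"
proof -
  have "{n. bsum n \<le> bsum (n + t)} = gain_ge 0 t"
    unfolding gain_ge_def by (intro Collect_cong) linarith
  then show ?thesis by (simp only: c_def gain_tail_def)
qed

lemma ct_eq_gain_tail: "ct t = gain_tail 1 t"
proof -
  have "{n. bsum n < bsum (n + t)} = gain_ge 1 t"
    unfolding gain_ge_def by (intro Collect_cong) linarith
  then show ?thesis by (simp only: ct_def gain_tail_def)
qed

text \<open>The recursion expresses the value at \<open>1\<close> through itself; linear growth in \<open>k\<close> is what
  makes its solution unique.\<close>

lemma recursion_unique:
  fixes \<Phi> :: "int \<Rightarrow> nat \<Rightarrow> real"
  assumes zero: "\<And>k. \<Phi> k 0 = 0"
    and even: "\<And>k t. \<Phi> k (2 * t) = \<Phi> k t"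
    and odd: "\<And>k t. \<Phi> k (2 * t + 1) = (\<Phi> (k - 1) t + \<Phi> (k + 1) (t + 1)) / 2"
    and growth: "\<And>k. \<bar>\<Phi> k 1\<bar> \<le> C * (1 + real_of_int \<bar>k\<bar>)"
  shows "\<Phi> k t = 0"
proof -
  have C0: "C \<ge> 0" using growth[of 0] by simp
  \<comment> \<open>At \<open>t = 0\<close> the odd rule reads
    \<open>\<Phi> k 1 = \<Phi> (k + 1) 1 / 2\<close>, because \<open>\<Phi>\<close> vanishes at
    0.\<close>
  have iter: "\<Phi> k 1 = \<Phi> (k + int j) 1 / 2 ^ j" for k j
  proof (induction j)
    case (Suc j)
    have "\<Phi> (k + int j) 1 = \<Phi> (k + int (Suc j)) 1 / 2"
      using odd[of "k + int j" 0] zero by (simp add: algebra_simps)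
    then have "\<Phi> (k + int j) 1 / 2 ^ j = \<Phi> (k + int (Suc j)) 1 / 2 ^ Suc j"
      by (simp add: field_simps)
    with Suc show ?case by (rule trans)
  qed simp
  have one: "\<Phi> k 1 = 0" for k
  proof -
    have "\<bar>\<Phi> k 1\<bar> \<le> C * (1 + \<bar>real_of_int k\<bar>) * (1/2) ^ j + C * (of_nat j * (1/2) ^ j)" for j
    proof -
      have "\<bar>\<Phi> k 1\<bar> = \<bar>\<Phi> (k + int j) 1\<bar> / 2 ^ j"
        by (subst iter[of k j]) (simp add: abs_divide)
      also have "\<dots> \<le> C * (1 + real_of_int \<bar>k + int j\<bar>) / 2 ^ j"
        by (intro divide_right_mono growth) simp
      also have "\<dots> \<le> C * (1 + \<bar>real_of_int k\<bar> + real j) / 2 ^ j"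
        by (intro divide_right_mono mult_left_mono C0) auto
      finally show ?thesis by (simp add: field_simps)
    qed
    moreover have "(\<lambda>j. C * (1 + \<bar>real_of_int k\<bar>) * (1/2) ^ j + C * (of_nat j * (1/2) ^ j)) \<longlonglongrightarrow>
        C * (1 + \<bar>real_of_int k\<bar>) * 0 + C * 0"
      by (intro tendsto_add tendsto_mult[OF tendsto_const] LIMSEQ_realpow_zero powser_times_n_limit_0) simp_all
    ultimately have "\<bar>\<Phi> k 1\<bar> \<le> C * (1 + \<bar>real_of_int k\<bar>) * 0 + C * 0"
      by (metis (no_types, lifting) LIMSEQ_le_const)
    then show ?thesis by simp
  qed
  show ?thesis
  proof (induction t arbitrary: k rule: less_induct)
    case (less t)
    consider "t = 0" | "t = 1" | u where "t = 2 * u" "u < t" | u where "t = 2 * u + 1" "u + 1 < t" "u < t"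
      by (rule nat_binary_cases)
    then show ?case
    proof cases
      case 1 then show ?thesis by (simp only: zero)
    next
      case 2 then show ?thesis by (simp only: one)
    next
      case (3 u)
      have "\<Phi> k t = \<Phi> k u" unfolding 3(1) by (rule even)
      then show ?thesis using less[OF 3(2)] by simp
    next
      case (4 u)
      have "\<Phi> k t = (\<Phi> (k - 1) u + \<Phi> (k + 1) (u + 1)) / 2" unfolding 4(1) by (rule odd)
      then show ?thesis using less[OF 4(2)] less[OF 4(3)] by simp
    qed
  qed
qed

section \<open>Fourier coefficients\<close>

text \<open>The value \<open>gam x t\<close> is the characteristic function at \<open>x\<close> of \<open>s(n+t) - s(n)\<close>.\<close>

function gam :: "real \<Rightarrow> nat \<Rightarrow> complex" where
  "gam x t = (if t = 0 then 1 else if t = 1 then cis x / (2 - cis (-x))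
     else if even t then gam x (t div 2)
     else (cis x * gam x (t div 2) + cis (-x) * gam x (t div 2 + 1)) / 2)"
  by auto
termination
  by (relation "Wellfounded.measure snd") (auto, presburger)

declare gam.simps [simp del]

lemma two_minus_cis_nonzero: "2 - cis x \<noteq> 0"
proof
  assume "2 - cis x = 0"
  then have "norm (cis x) = norm (2::complex)" by simp
  then show False by simp
qed

lemma gam_0: "gam x 0 = 1"
  by (simp add: gam.simps)

lemma gam_1: "gam x 1 = cis x / (2 - cis (-x))"
  by (simp add: gam.simps)

lemma gam_even: "gam x (2 * t) = gam x t"
  by (cases "t = 0") (simp_all add: gam.simps[of x "2 * t"])

lemma gam_odd: "gam x (2 * t + 1) = (cis x * gam x t + cis (-x) * gam x (t + 1)) / 2"
proof (cases "t = 0")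
  \<comment> \<open>Here the claim is the equation \<open>g = (cis x + cis (-x) * g) / 2\<close>;
    the value chosen for \<open>gam x 1\<close> is its solution.\<close>
  case True
  then show ?thesis
    using two_minus_cis_nonzero[of "-x"] by (simp add: gam_0 gam_1[simplified] field_simps)
next
  case False
  then have "2 * t + 1 \<noteq> 0" "2 * t + 1 \<noteq> 1" "odd (2 * t + 1)" "(2 * t + 1) div 2 = t" by simp_all
  then show ?thesis by (subst gam.simps) (simp only: if_False)
qed

lemma gam_induct [case_names zero one even odd]:
  fixes t :: nat
  assumes "P 0" "P 1" "\<And>u. P u \<Longrightarrow> P (2 * u)" "\<And>u. P u \<Longrightarrow> P (u + 1) \<Longrightarrow> P (2 * u + 1)"
  shows "P t"
proof (induction t rule: less_induct)
  case (less t)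
  show ?case by (rule nat_binary_cases[of t]) (use assms less in simp_all)
qed

lemma continuous_on_cis_compose: "continuous_on A f \<Longrightarrow> continuous_on A (\<lambda>x. cis (f x))"
  unfolding cis_conv_exp by (intro continuous_intros)

lemma continuous_on_gam: "continuous_on A (\<lambda>x. gam x t)"
proof (induction t rule: gam_induct)
  case zero show ?case by (simp add: gam_0)
next
  case one show ?case unfolding gam_1
    by (intro continuous_intros continuous_on_cis_compose ballI two_minus_cis_nonzero)
next
  case (even u) then show ?case by (simp add: gam_even)
next
  case (odd u) then show ?case unfolding gam_odd
    by (intro continuous_intros continuous_on_cis_compose) simp_all
qed

lemma measurable_gam [measurable]: "(\<lambda>x. gam x t) \<in> borel_measurable borel"
  by (rule borel_measurable_continuous_onI[OF continuous_on_gam])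

lemma measurable_cis [measurable]: "cis \<in> borel_measurable borel"
  using borel_measurable_continuous_onI[OF continuous_on_cis_compose[OF continuous_on_id]] by simp

lemma norm_cis_minus_1_le: "norm (cis x - 1) \<le> \<bar>x\<bar>"
proof -
  have "(norm (cis x - 1))\<^sup>2 = 2 - 2 * cos x"
    unfolding cmod_power2 using sin_cos_squared_add[of x] by (simp add: power2_eq_square algebra_simps)
  also have "\<dots> = (2 * sin (x / 2))\<^sup>2"
    using cos_double_sin[of "x / 2"] by (simp add: power2_eq_square)
  also have "\<dots> \<le> x\<^sup>2"
    using abs_sin_x_le_abs_x[of "x / 2"] by (subst abs_le_square_iff[symmetric]) simp
  finally show ?thesis using abs_le_square_iff[of "norm (cis x - 1)" x] by simp
qed

lemma norm_gam_1_minus_1_le: "norm (gam x 1 - 1) \<le> 2 * \<bar>x\<bar>"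
proof -
  have "gam x 1 - 1 = ((cis x - 1) + (cis (-x) - 1)) / (2 - cis (-x))"
    unfolding gam_1 using two_minus_cis_nonzero[of "-x"] by (simp add: field_simps)
  moreover have "norm (2 - cis (-x)) \<ge> 1"
    using norm_triangle_ineq2[of 2 "cis (-x)"] by simp
  moreover have "norm ((cis x - 1) + (cis (-x) - 1)) \<le> 2 * \<bar>x\<bar>"
    using norm_triangle_ineq[of "cis x - 1" "cis (-x) - 1"]
      norm_cis_minus_1_le[of x] norm_cis_minus_1_le[of "-x"] by simp
  ultimately show ?thesis
    by (simp add: norm_divide divide_le_eq mult_le_cancel_left1)
       (smt (verit) mult_le_cancel_left1)
qed

text \<open>Vanishing to first order at 0 keeps the product of the imaginary part with
  \<open>cot (x / 2)\<close> bounded near the pole. The constant may depend on t, since it serves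
  one t at a time.\<close>

lemma norm_gam_minus_1_le: "\<exists>C\<ge>0. \<forall>x. norm (gam x t - 1) \<le> C * \<bar>x\<bar>"
proof (induction t rule: gam_induct)
  case zero then show ?case by (auto simp: gam_0 intro: exI[of _ 0])
next
  case one then show ?case using norm_gam_1_minus_1_le by (intro exI[of _ 2]) auto
next
  case (even u) then show ?case by (simp add: gam_even)
next
  case (odd u)
  then obtain C C' where C: "C \<ge> 0" "\<And>x. norm (gam x u - 1) \<le> C * \<bar>x\<bar>"
    "C' \<ge> 0" "\<And>x. norm (gam x (u + 1) - 1) \<le> C' * \<bar>x\<bar>" by blast
  have "norm (gam x (2 * u + 1) - 1) \<le> (C + C' + 2) * \<bar>x\<bar>" for x
  proof -
    have "gam x (2 * u + 1) - 1 = (cis x * (gam x u - 1) + cis (-x) * (gam x (u + 1) - 1)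
        + ((cis x - 1) + (cis (-x) - 1))) / 2"
      unfolding gam_odd by (simp add: field_simps)
    also have "norm \<dots> \<le> (norm (gam x u - 1) + norm (gam x (u + 1) - 1)
        + (norm (cis x - 1) + norm (cis (-x) - 1))) / 2"
      unfolding norm_divide
      by (intro order_trans[OF norm_triangle_ineq] divide_mono add_mono) (auto simp: norm_mult)
    also have "\<dots> \<le> (C + C' + 2) * \<bar>x\<bar>"
      using C(2)[of x] C(4)[of x] norm_cis_minus_1_le[of x] norm_cis_minus_1_le[of "-x"]
        mult_nonneg_nonneg[OF C(1), of "\<bar>x\<bar>"] mult_nonneg_nonneg[OF C(3), of "\<bar>x\<bar>"] norm_ge_zero
      by (simp add: algebra_simps)
    finally show ?thesis .
  qed
  then show ?case using C by (intro exI[of _ "C + C' + 2"]) auto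
qed

text \<open>The bound is linear in \<open>k\<close> because this is the growth that
  \<open>recursion_unique\<close> admits.\<close>

lemma norm_gam_cis_minus_1_le:
  "\<exists>C\<ge>0. \<forall>x k. norm (gam x t * cis (- (of_int k * x)) - 1) \<le> C * (1 + \<bar>real_of_int k\<bar>) * \<bar>x\<bar>"
proof -
  obtain C where C: "C \<ge> 0" "\<And>x. norm (gam x t - 1) \<le> C * \<bar>x\<bar>"
    using norm_gam_minus_1_le by blast
  have "norm (gam x t * cis (- (of_int k * x)) - 1) \<le> (C + 1) * (1 + \<bar>real_of_int k\<bar>) * \<bar>x\<bar>" for x k
  proof -
    have "gam x t * cis (- (of_int k * x)) - 1
        = (gam x t - 1) * cis (- (of_int k * x)) + (cis (- (of_int k * x)) - 1)"
      by (simp add: algebra_simps)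
    also have "norm \<dots> \<le> norm (gam x t - 1) + norm (cis (- (of_int k * x)) - 1)"
      by (rule order_trans[OF norm_triangle_ineq]) (simp add: norm_mult)
    also have "\<dots> \<le> C * \<bar>x\<bar> + \<bar>real_of_int k\<bar> * \<bar>x\<bar>"
      using C(2)[of x] norm_cis_minus_1_le[of "- (of_int k * x)"] by (simp add: abs_mult)
    also have "\<dots> \<le> (C + 1) * (1 + \<bar>real_of_int k\<bar>) * \<bar>x\<bar>"
      using C(1) by (simp add: algebra_simps)
    finally show ?thesis .
  qed
  then show ?thesis using C by (intro exI[of _ "C + 1"]) auto
qed

text \<open>Jordan's inequality: the concave sine lies above its chord on
  \<open>{0..pi/2}\<close>.\<close>

lemma sin_half_ge:
  assumes "0 \<le> x" "x \<le> pi" shows "x / pi \<le> sin (x / 2)"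
proof -
  have "concave_on {0..pi/2} sin"
  proof (rule f''_le0_imp_concave)
    fix y :: real assume "y \<in> {0..pi/2}"
    show "(sin has_real_derivative cos y) (at y)" "(cos has_real_derivative - sin y) (at y)"
      by (auto intro!: derivative_eq_intros)
    show "- sin y \<le> 0" using \<open>y \<in> _\<close> by (auto intro!: sin_ge_zero)
  qed auto
  from concave_onD[OF this, of "x / pi" 0 "pi / 2"] show ?thesis
    using assms by (simp add: field_simps)
qed

text \<open>The real part of \<open>gam\<close>, and its imaginary part times
  \<open>cot (x / 2)\<close>, are even in x. Half a period thus suffices, with normalising factor
  \<open>pi\<close>.\<close>

abbreviation half_circle :: "real measure" where
  "half_circle \<equiv> restrict_space lborel {0..pi}"

lemma emeasure_half_circle: "emeasure half_circle (space half_circle) = ennreal pi"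
  by (simp add: emeasure_restrict_space space_restrict_space)

lemma finite_measure_half_circle: "finite_measure half_circle"
  by (rule finite_measureI, unfold emeasure_half_circle) simp

lemma measurable_half_circle: "f \<in> borel_measurable borel \<Longrightarrow> f \<in> borel_measurable half_circle"
  by (rule measurable_restrict_space1) simp

lemma integrable_half_circle_bounded:
  fixes f :: "real \<Rightarrow> real"
  assumes "f \<in> borel_measurable borel" "\<And>x. \<lbrakk>0 \<le> x; x \<le> pi\<rbrakk> \<Longrightarrow> \<bar>f x\<bar> \<le> B"
  shows "integrable half_circle f"
  by (rule finite_measure.integrable_const_bound[OF finite_measure_half_circle _ measurable_half_circle[OF assms(1)], of B])
    (auto intro!: AE_I2 assms(2) simp: space_restrict_space)

lemma integral_half_circle_FTC:
  fixes f :: "real \<Rightarrow> real"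
  assumes "\<And>x. (F has_real_derivative f x) (at x)" "continuous_on UNIV f"
  shows "(LINT x|half_circle. f x) = F pi - F 0"
proof -
  have "(LINT x|half_circle. f x) = (LINT x|lborel. f x * indicator {0..pi} x)"
    by (subst integral_restrict_space) (auto simp: mult.commute)
  also have "\<dots> = F pi - F 0"
    by (rule integral_FTC_Icc_real)
      (use assms in \<open>auto simp: continuous_on_eq_continuous_at\<close>)
  finally show ?thesis .
qed

lemma integral_half_circle_mono:
  assumes "integrable half_circle f" "integrable half_circle g" "\<And>x. \<lbrakk>0 \<le> x; x \<le> pi\<rbrakk> \<Longrightarrow> f x \<le> (g x :: real)"
  shows "(LINT x|half_circle. f x) \<le> (LINT x|half_circle. g x)"
  by (rule integral_mono[OF assms(1,2)]) (auto simp: space_restrict_space intro: assms(3))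

text \<open>The point 0 is left out because \<open>cot (x / 2)\<close> has the default value 0
  there, so that trigonometric identities containing it can fail.\<close>

lemma integral_half_circle_cong:
  assumes "\<And>x. \<lbrakk>0 < x; x \<le> pi\<rbrakk> \<Longrightarrow> f x = (g x :: real)"
    "f \<in> borel_measurable borel" "g \<in> borel_measurable borel"
  shows "(LINT x|half_circle. f x) = (LINT x|half_circle. g x)"
proof (rule integral_cong_AE)
  have "AE x in lborel. x \<noteq> (0::real)" by (rule AE_lborel_singleton)
  then have "AE x in half_circle. x \<noteq> 0" by (auto simp: AE_restrict_space_iff)
  moreover have "AE x in half_circle. 0 \<le> x \<and> x \<le> pi" by (auto intro!: AE_I2 simp: space_restrict_space)
  ultimately show "AE x in half_circle. f x = g x"
    by eventually_elim (use assms(1) in auto)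
qed (use assms measurable_half_circle in auto)

lemma measure_half_circle: "measure half_circle (space half_circle) = pi"
  unfolding measure_def emeasure_half_circle by simp

lemma integral_half_circle_const: "(LINT x|half_circle. a) = pi * (a::real)"
  using measure_half_circle by simp

lemma integral_half_circle_cos: "(LINT x|half_circle. cos (of_int k * x)) = (if k = 0 then pi else 0)"
proof (cases "k = 0")
  case False
  have "(LINT x|half_circle. cos (of_int k * x)) = sin (of_int k * pi) / of_int k - sin (of_int k * 0) / of_int k"
    by (rule integral_half_circle_FTC)
      (use False in \<open>auto intro!: derivative_eq_intros continuous_intros\<close>)
  then show ?thesis using False sin_zero_iff_int2[of "of_int k * pi"] by simp
qed (use measure_half_circle in simp)

lemma measurable_cot_half [measurable]: "(\<lambda>x::real. cot (x / 2)) \<in> borel_measurable borel"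
  unfolding cot_def by measurable

lemma abs_mult_cot_half_le:
  assumes "0 \<le> x" "x \<le> pi" "\<bar>y\<bar> \<le> A * x" "A \<ge> 0"
  shows "\<bar>y * cot (x / 2)\<bar> \<le> A * pi"
proof (cases "x = 0")
  case False
  with assms have x: "x > 0" by simp
  then have s: "sin (x / 2) > 0" using assms by (intro sin_gt_zero) auto
  have "\<bar>y * cot (x / 2)\<bar> = \<bar>y\<bar> * \<bar>cos (x / 2)\<bar> / sin (x / 2)"
    using s by (simp add: cot_def abs_mult)
  also have "\<dots> \<le> (A * x) * 1 / sin (x / 2)"
    using s assms(3) by (intro divide_right_mono mult_mono) auto
  also have "\<dots> \<le> (A * x) * 1 / (x / pi)"
    using s x sin_half_ge[OF assms(1,2)] assms(3) by (intro divide_left_mono mult_pos_pos) auto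
  finally show ?thesis using x by simp
qed (use assms in simp)

lemma integrable_sin_cot: "integrable half_circle (\<lambda>x. sin (of_int k * x) * cot (x / 2))"
proof (rule integrable_half_circle_bounded)
  fix x assume x: "0 \<le> x" "x \<le> pi"
  have "\<bar>sin (of_int k * x)\<bar> \<le> \<bar>of_int k\<bar> * x"
    using abs_sin_x_le_abs_x[of "of_int k * x"] x by (simp add: abs_mult)
  from abs_mult_cot_half_le[OF x this abs_ge_zero]
  show "\<bar>sin (of_int k * x) * cot (x / 2)\<bar> \<le> \<bar>of_int k\<bar> * pi" .
qed measurable

lemma integrable_cos: "integrable half_circle (\<lambda>x. cos (of_int k * x))"
  by (rule integrable_half_circle_bounded[of _ 1]) auto

text \<open>Telescoping: raising the frequency from n to n + 1 adds
  \<open>cos ((n + 1) * x) + cos (n * x)\<close> to the integrand, and only n = 0 contributes to the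
  integral. So \<open>cot (x / 2)\<close> turns a frequency into its sign, which is how P(X > 0) -
  P(X < 0) arises from the characteristic function.\<close>

lemma integral_half_circle_sin_cot: "(LINT x|half_circle. sin (of_int k * x) * cot (x / 2)) = pi * sgn (of_int k)"
proof -
  have pos: "(LINT x|half_circle. sin (of_int (int n) * x) * cot (x / 2)) = (if n = 0 then 0 else pi)" for n
  proof (induction n)
    case (Suc n)
    have "(LINT x|half_circle. sin (of_int (int (Suc n)) * x) * cot (x / 2))
        = (LINT x|half_circle. sin (of_int (int n) * x) * cot (x / 2)
             + (cos (of_int (int (Suc n)) * x) + cos (of_int (int n) * x)))"
    proof (rule integral_half_circle_cong)
      fix x :: real assume x: "0 < x" "x \<le> pi"
      then have s: "sin (x / 2) > 0" by (intro sin_gt_zero) auto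
      define u where "u = real n * x + x / 2"
      have "sin (u + x / 2) - sin (u - x / 2) = 2 * cos u * sin (x / 2)"
        "cos (u + x / 2) + cos (u - x / 2) = 2 * cos u * cos (x / 2)"
        by (simp_all add: sin_add sin_diff cos_add cos_diff)
      moreover have "u + x / 2 = of_int (int (Suc n)) * x" "u - x / 2 = of_int (int n) * x"
        by (simp_all add: u_def algebra_simps)
      ultimately have diff: "sin (of_int (int (Suc n)) * x) - sin (of_int (int n) * x) = 2 * cos u * sin (x / 2)"
        and sum: "cos (of_int (int (Suc n)) * x) + cos (of_int (int n) * x) = 2 * cos u * cos (x / 2)"
        by simp_all
      have "(sin (of_int (int (Suc n)) * x) - sin (of_int (int n) * x)) * cot (x / 2)
          = cos (of_int (int (Suc n)) * x) + cos (of_int (int n) * x)"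
        unfolding diff sum cot_def using s by simp
      then show "sin (of_int (int (Suc n)) * x) * cot (x / 2) = sin (of_int (int n) * x) * cot (x / 2)
          + (cos (of_int (int (Suc n)) * x) + cos (of_int (int n) * x))"
        by (simp add: algebra_simps)
    qed measurable
    also have "\<dots> = (LINT x|half_circle. sin (of_int (int n) * x) * cot (x / 2))
        + ((LINT x|half_circle. cos (of_int (int (Suc n)) * x)) + (LINT x|half_circle. cos (of_int (int n) * x)))"
      by (intro Bochner_Integration.integral_add[THEN trans] arg_cong2[of _ _ _ _ "(+)"]
          Bochner_Integration.integral_add integrable_sin_cot integrable_cos Bochner_Integration.integrable_add refl)
    also have "\<dots> = pi"
      unfolding integral_half_circle_cos Suc by simp
    finally show ?case by simp
  qed simp
  show ?thesis
  proof (cases "k \<ge> 0")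
    case True
    then obtain n where "k = int n" using nonneg_int_cases by blast
    then show ?thesis using pos[of n] by (simp add: sgn_if)
  next
    case False
    then obtain n where k: "k = - int n" "n > 0" by (metis linorder_not_le neg_int_cases)
    have "(LINT x|half_circle. sin (of_int k * x) * cot (x / 2))
        = (LINT x|half_circle. - (sin (of_int (int n) * x) * cot (x / 2)))"
      by (rule Bochner_Integration.integral_cong) (simp_all add: k)
    then show ?thesis using pos[of n] k by (simp add: sgn_if)
  qed
qed

text \<open>For the gain X, this is \<open>pi\<close> times P(X = k), and
  \<open>im_coeff k t\<close> below is \<open>pi\<close> times the mean of the sign of X -
  k.\<close>

definition re_coeff :: "int \<Rightarrow> nat \<Rightarrow> real" where
  "re_coeff k t = (LINT x|half_circle. Re (gam x t * cis (- (of_int k * x))))"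

definition im_coeff :: "int \<Rightarrow> nat \<Rightarrow> real" where
  "im_coeff k t = (LINT x|half_circle. Im (gam x t * cis (- (of_int k * x))) * cot (x / 2))"

lemma abs_Re_gam_le:
  "\<exists>C\<ge>0. \<forall>k x. 0 \<le> x \<longrightarrow> x \<le> pi \<longrightarrow> \<bar>Re (gam x t * cis (- (of_int k * x)))\<bar> \<le> C * (1 + \<bar>real_of_int k\<bar>)"
proof -
  obtain C where C: "C \<ge> 0"
    "\<And>x k. norm (gam x t * cis (- (of_int k * x)) - 1) \<le> C * (1 + \<bar>real_of_int k\<bar>) * \<bar>x\<bar>"
    using norm_gam_cis_minus_1_le by blast
  have "\<bar>Re (gam x t * cis (- (of_int k * x)))\<bar> \<le> (C * pi + 1) * (1 + \<bar>real_of_int k\<bar>)"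
    if x: "0 \<le> x" "x \<le> pi" for k x
  proof -
    have "\<bar>Re (gam x t * cis (- (of_int k * x)))\<bar> \<le> norm (gam x t * cis (- (of_int k * x)))"
      by (rule abs_Re_le_cmod)
    also have "\<dots> \<le> norm (gam x t * cis (- (of_int k * x)) - 1) + norm (1 :: complex)"
      using norm_triangle_sub[of _ "1 :: complex"] by (simp add: add.commute)
    also have "\<dots> \<le> C * (1 + \<bar>real_of_int k\<bar>) * pi + (1 + \<bar>real_of_int k\<bar>)"
    proof (rule add_mono)
      have "C * (1 + \<bar>real_of_int k\<bar>) * \<bar>x\<bar> \<le> C * (1 + \<bar>real_of_int k\<bar>) * pi"
        using x C(1) by (intro mult_left_mono) auto
      with C(2)[of x k] show "norm (gam x t * cis (- (of_int k * x)) - 1) \<le> C * (1 + \<bar>real_of_int k\<bar>) * pi"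
        by linarith
    qed simp
    finally show ?thesis by (simp add: algebra_simps)
  qed
  then show ?thesis using C(1) by (intro exI[of _ "C * pi + 1"]) auto
qed

lemma abs_Im_gam_cot_le:
  "\<exists>C\<ge>0. \<forall>k x. 0 \<le> x \<longrightarrow> x \<le> pi \<longrightarrow>
     \<bar>Im (gam x t * cis (- (of_int k * x))) * cot (x / 2)\<bar> \<le> C * (1 + \<bar>real_of_int k\<bar>)"
proof -
  obtain C where C: "C \<ge> 0"
    "\<And>x k. norm (gam x t * cis (- (of_int k * x)) - 1) \<le> C * (1 + \<bar>real_of_int k\<bar>) * \<bar>x\<bar>"
    using norm_gam_cis_minus_1_le by blast
  have "\<bar>Im (gam x t * cis (- (of_int k * x))) * cot (x / 2)\<bar> \<le> C * (1 + \<bar>real_of_int k\<bar>) * pi"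
    if x: "0 \<le> x" "x \<le> pi" for k x
  proof (rule abs_mult_cot_half_le[OF x _ mult_nonneg_nonneg[OF C(1)]])
    have "\<bar>Im (gam x t * cis (- (of_int k * x)))\<bar> = \<bar>Im (gam x t * cis (- (of_int k * x)) - 1)\<bar>"
      by simp
    also have "\<dots> \<le> norm (gam x t * cis (- (of_int k * x)) - 1)" by (rule abs_Im_le_cmod)
    also have "\<dots> \<le> C * (1 + \<bar>real_of_int k\<bar>) * x" using C(2)[of x k] x by simp
    finally show "\<bar>Im (gam x t * cis (- (of_int k * x)))\<bar> \<le> C * (1 + \<bar>real_of_int k\<bar>) * x" .
  qed simp
  then show ?thesis using C(1) by (intro exI[of _ "C * pi"]) (auto simp: algebra_simps)
qed

lemma integrable_Re_gam: "integrable half_circle (\<lambda>x. Re (gam x t * cis (- (of_int k * x))))"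
proof -
  obtain C where "\<And>k x. 0 \<le> x \<Longrightarrow> x \<le> pi \<Longrightarrow> \<bar>Re (gam x t * cis (- (of_int k * x)))\<bar> \<le> C * (1 + \<bar>real_of_int k\<bar>)"
    using abs_Re_gam_le[of t] by blast
  then show ?thesis by (intro integrable_half_circle_bounded) measurable
qed

lemma integrable_Im_gam_cot: "integrable half_circle (\<lambda>x. Im (gam x t * cis (- (of_int k * x))) * cot (x / 2))"
proof -
  obtain C where "\<And>k x. 0 \<le> x \<Longrightarrow> x \<le> pi \<Longrightarrow>
      \<bar>Im (gam x t * cis (- (of_int k * x))) * cot (x / 2)\<bar> \<le> C * (1 + \<bar>real_of_int k\<bar>)"
    using abs_Im_gam_cot_le[of t] by blast
  then show ?thesis by (intro integrable_half_circle_bounded) measurable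
qed

lemma abs_integral_half_circle_le:
  assumes "integrable half_circle f" "\<And>x. 0 \<le> x \<Longrightarrow> x \<le> pi \<Longrightarrow> \<bar>f x\<bar> \<le> (B::real)"
  shows "\<bar>LINT x|half_circle. f x\<bar> \<le> pi * B"
proof -
  interpret finite_measure half_circle by (rule finite_measure_half_circle)
  have "\<bar>LINT x|half_circle. f x\<bar> \<le> (LINT x|half_circle. \<bar>f x\<bar>)" by (rule integral_abs_bound)
  also have "\<dots> \<le> (LINT x|half_circle. B)"
    by (rule integral_half_circle_mono) (use assms in auto)
  finally show ?thesis unfolding integral_half_circle_const .
qed

text \<open>The factors \<open>cis x\<close> and \<open>cis (-x)\<close> shift the frequency by one,
  exactly as the threshold moves in \<open>gain_tail_odd\<close>.\<close>

lemma gam_cis_odd: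
  "gam x (2 * t + 1) * cis (- (of_int k * x))
     = (gam x t * cis (- (of_int (k - 1) * x)) + gam x (t + 1) * cis (- (of_int (k + 1) * x))) / 2"
proof -
  have "cis (- (of_int (k - 1) * x)) = cis x * cis (- (of_int k * x))"
    "cis (- (of_int (k + 1) * x)) = cis (-x) * cis (- (of_int k * x))"
    by (simp_all add: cis_mult algebra_simps)
  then show ?thesis unfolding gam_odd by (simp only: distrib_right mult_ac times_divide_eq_right)
      (simp add: field_simps)
qed

lemma integral_half_circle_mean:
  assumes "integrable half_circle f" "integrable half_circle g"
  shows "(LINT x|half_circle. (f x + g x) / 2) = ((LINT x|half_circle. f x) + (LINT x|half_circle. g x) :: real) / 2"
  using Bochner_Integration.integral_add[OF assms] by simp

lemma re_coeff_odd: "re_coeff k (2 * t + 1) = (re_coeff (k - 1) t + re_coeff (k + 1) (t + 1)) / 2"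
proof -
  have Re_mean: "Re ((a + b) / 2) = (Re a + Re b) / 2" for a b by simp
  show ?thesis
    unfolding re_coeff_def gam_cis_odd Re_mean by (intro integral_half_circle_mean integrable_Re_gam)
qed

lemma im_coeff_odd: "im_coeff k (2 * t + 1) = (im_coeff (k - 1) t + im_coeff (k + 1) (t + 1)) / 2"
proof -
  have Im_mean: "Im ((a + b) / 2) * r = (Im a * r + Im b * r) / 2" for a b r
    by (simp add: distrib_right add_divide_distrib)
  show ?thesis
    unfolding im_coeff_def gam_cis_odd Im_mean by (intro integral_half_circle_mean integrable_Im_gam_cot)
qed

text \<open>The difference of the two sides vanishes at t = 0, obeys the digit recursion and grows
  at most linearly in \<open>k\<close> at t = 1, so \<open>recursion_unique\<close> applies.\<close>

lemma gain_tail_diff_eq: "pi * (gain_tail k t - gain_tail (k + 1) t) = re_coeff k t"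
proof -
  let ?\<Phi> = "\<lambda>k t. re_coeff k t - pi * (gain_tail k t - gain_tail (k + 1) t)"
  obtain C where C: "C \<ge> 0" "\<And>k x. 0 \<le> x \<Longrightarrow> x \<le> pi \<Longrightarrow>
      \<bar>Re (gam x 1 * cis (- (of_int k * x)))\<bar> \<le> C * (1 + \<bar>real_of_int k\<bar>)"
    using abs_Re_gam_le[of 1] by blast
  have "?\<Phi> k t = 0"
  proof (rule recursion_unique[of ?\<Phi> "pi * C + 2 * pi"])
    fix k
    show "?\<Phi> k 0 = 0"
      using integral_half_circle_cos[of k] by (auto simp: re_coeff_def gam_0 gain_tail_0)
    have "\<bar>gain_tail k 1 - gain_tail (k + 1) 1\<bar> \<le> 1"
      using gain_tail_bounds[of k 1] gain_tail_bounds[of "k + 1" 1] by linarith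
    then have "\<bar>pi * (gain_tail k 1 - gain_tail (k + 1) 1)\<bar> \<le> pi"
      by (simp add: abs_mult del: One_nat_def)
    moreover have "\<bar>re_coeff k 1\<bar> \<le> pi * (C * (1 + \<bar>real_of_int k\<bar>))"
      unfolding re_coeff_def by (intro abs_integral_half_circle_le integrable_Re_gam C)
    ultimately have "\<bar>?\<Phi> k 1\<bar> \<le> pi * (C * (1 + \<bar>real_of_int k\<bar>)) + pi" by linarith
    also have "\<dots> \<le> (pi * C + 2 * pi) * (1 + \<bar>real_of_int k\<bar>)" by (simp add: algebra_simps)
    finally show "\<bar>?\<Phi> k 1\<bar> \<le> (pi * C + 2 * pi) * (1 + real_of_int \<bar>k\<bar>)" by simp
    fix t
    show "?\<Phi> k (2 * t) = ?\<Phi> k t" by (simp add: re_coeff_def gam_even gain_tail_even)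
    show "?\<Phi> k (2 * t + 1) = (?\<Phi> (k - 1) t + ?\<Phi> (k + 1) (t + 1)) / 2"
      unfolding re_coeff_odd gain_tail_odd by (simp add: field_simps)
  qed
  then show ?thesis by simp
qed

lemma gain_tail_sum_eq: "pi * (gain_tail k t + gain_tail (k + 1) t - 1) = im_coeff k t"
proof -
  let ?\<Phi> = "\<lambda>k t. im_coeff k t - pi * (gain_tail k t + gain_tail (k + 1) t - 1)"
  obtain C where C: "C \<ge> 0" "\<And>k x. 0 \<le> x \<Longrightarrow> x \<le> pi \<Longrightarrow>
      \<bar>Im (gam x 1 * cis (- (of_int k * x))) * cot (x / 2)\<bar> \<le> C * (1 + \<bar>real_of_int k\<bar>)"
    using abs_Im_gam_cot_le[of 1] by blast
  have "?\<Phi> k t = 0"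
  proof (rule recursion_unique[of ?\<Phi> "pi * C + 2 * pi"])
    fix k
    show "?\<Phi> k 0 = 0"
      using integral_half_circle_sin_cot[of k] by (auto simp: im_coeff_def gam_0 gain_tail_0 sgn_if)
    have "\<bar>gain_tail k 1 + gain_tail (k + 1) 1 - 1\<bar> \<le> 1"
      using gain_tail_bounds[of k 1] gain_tail_bounds[of "k + 1" 1] by linarith
    then have "\<bar>pi * (gain_tail k 1 + gain_tail (k + 1) 1 - 1)\<bar> \<le> pi"
      by (simp add: abs_mult del: One_nat_def)
    moreover have "\<bar>im_coeff k 1\<bar> \<le> pi * (C * (1 + \<bar>real_of_int k\<bar>))"
      unfolding im_coeff_def by (intro abs_integral_half_circle_le integrable_Im_gam_cot C)
    ultimately have "\<bar>?\<Phi> k 1\<bar> \<le> pi * (C * (1 + \<bar>real_of_int k\<bar>)) + pi" by linarith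
    also have "\<dots> \<le> (pi * C + 2 * pi) * (1 + \<bar>real_of_int k\<bar>)" by (simp add: algebra_simps)
    finally show "\<bar>?\<Phi> k 1\<bar> \<le> (pi * C + 2 * pi) * (1 + real_of_int \<bar>k\<bar>)" by simp
    fix t
    show "?\<Phi> k (2 * t) = ?\<Phi> k t" by (simp add: im_coeff_def gam_even gain_tail_even)
    show "?\<Phi> k (2 * t + 1) = (?\<Phi> (k - 1) t + ?\<Phi> (k + 1) (t + 1)) / 2"
      unfolding im_coeff_odd gain_tail_odd by (simp add: field_simps)
  qed
  then show ?thesis by simp
qed

lemma c_minus_ct: "pi * (c t - ct t) = (LINT x|half_circle. Re (gam x t))"
  using gain_tail_diff_eq[of 0 t] by (simp add: re_coeff_def c_eq_gain_tail ct_eq_gain_tail)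

lemma c_plus_ct: "pi * (c t + ct t - 1) = (LINT x|half_circle. Im (gam x t) * cot (x / 2))"
  using gain_tail_sum_eq[of 0 t] by (simp add: im_coeff_def c_eq_gain_tail ct_eq_gain_tail)

section \<open>Averages over the binary digits of t\<close>

definition avg :: "nat \<Rightarrow> (nat \<Rightarrow> real) \<Rightarrow> real" where
  "avg n f = (\<Sum>t<2 ^ n. f t) / 2 ^ n"

lemma avg_0: "avg 0 f = f 0"
  by (simp add: avg_def)

lemma sum_double: "(\<Sum>t<2 * m. f t) = (\<Sum>t<m. f (2 * t) + f (2 * t + 1))" for f :: "nat \<Rightarrow> real"
  by (induction m) simp_all

text \<open>The new digit is the lowest one, the end of t at which the recursion of
  \<open>gam\<close> works.\<close>

lemma avg_Suc: "avg (Suc n) f = avg n (\<lambda>t. (f (2 * t) + f (2 * t + 1)) / 2)"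
  unfolding avg_def power_Suc sum_double sum_divide_distrib[symmetric] by simp

lemma avg_add: "avg n (\<lambda>t. f t + g t) = avg n f + avg n g"
  by (simp add: avg_def sum.distrib add_divide_distrib)

lemma avg_diff: "avg n (\<lambda>t. f t - g t) = avg n f - avg n g"
  by (simp add: avg_def sum_subtractf diff_divide_distrib)

lemma avg_cmult: "avg n (\<lambda>t. a * f t) = a * avg n f"
  by (simp add: avg_def sum_distrib_left)

lemma avg_divide: "avg n (\<lambda>t. f t / a) = avg n f / a"
  by (simp add: avg_def sum_divide_distrib mult.commute)

lemma avg_mono: "(\<And>t. f t \<le> g t) \<Longrightarrow> avg n f \<le> avg n g"
  unfolding avg_def by (intro divide_right_mono sum_mono) auto

lemma avg_nonneg: "(\<And>t. 0 \<le> f t) \<Longrightarrow> 0 \<le> avg n f"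
  unfolding avg_def by (intro divide_nonneg_pos sum_nonneg) auto

lemma avg_cong: "(\<And>t. f t = g t) \<Longrightarrow> avg n f = avg n g"
  by (simp add: avg_def)

lemmas avg_linear = avg_add avg_diff avg_cmult avg_divide

text \<open>The source term decays at the same rate as the homogeneous solution. This resonance is
  the origin of the factor n in the mean square bounds.\<close>

lemma geometric_bound:
  fixes u :: "nat \<Rightarrow> real"
  assumes "u 0 \<le> a" "\<And>n. u (Suc n) \<le> r * u n + b * r ^ Suc n" "0 \<le> r"
  shows "u n \<le> (a + n * b) * r ^ n"
proof (induction n)
  case (Suc n)
  have "u (Suc n) \<le> r * u n + b * r ^ Suc n" by (rule assms)
  also have "\<dots> \<le> r * ((a + n * b) * r ^ n) + b * r ^ Suc n"
    using Suc assms(3) by (intro add_right_mono mult_left_mono)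
  finally show ?case by (simp add: algebra_simps)
qed (use assms in simp)

text \<open>Half sums and half differences of the real and imaginary parts of the pair
  \<open>gam x t\<close>, \<open>gam x (t + 1)\<close>. Appending a binary digit to \<open>t\<close> acts on these
  four numbers by a linear map, and the digits 0 and 1 differ only by a sign.\<close>

definition re_mid :: "real \<Rightarrow> nat \<Rightarrow> real" where
  "re_mid x t = (Re (gam x t) + Re (gam x (t + 1))) / 2"
definition re_dif :: "real \<Rightarrow> nat \<Rightarrow> real" where
  "re_dif x t = (Re (gam x t) - Re (gam x (t + 1))) / 2"
definition im_mid :: "real \<Rightarrow> nat \<Rightarrow> real" where
  "im_mid x t = (Im (gam x t) + Im (gam x (t + 1))) / 2"
definition im_dif :: "real \<Rightarrow> nat \<Rightarrow> real" where
  "im_dif x t = (Im (gam x t) - Im (gam x (t + 1))) / 2"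

text \<open>The versine, the parameter k of the overview. The square of \<open>sin x\<close> is a
  polynomial in it, so all estimates can be stated in powers of \<open>vers x\<close>.\<close>

definition vers :: "real \<Rightarrow> real" where
  "vers x = 1 - cos x"

lemmas mid_dif_defs = re_mid_def re_dif_def im_mid_def im_dif_def

lemma gam_next:
  "gam x (2 * t) = gam x t"
  "gam x (2 * t + 1) = (cis x * gam x t + cis (-x) * gam x (t + 1)) / 2"
  "gam x (2 * t + 1 + 1) = gam x (t + 1)"
  using gam_even[of x t] gam_odd[of x t] gam_even[of x "t + 1"] by simp_all

lemma step_even:
  "re_mid x (2 * t) = ((2 - vers x) * re_mid x t + re_dif x t - sin x * im_dif x t) / 2"
  "re_dif x (2 * t) = (re_dif x t + (vers x * re_mid x t + sin x * im_dif x t)) / 2"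
  "im_mid x (2 * t) = ((2 - vers x) * im_mid x t + sin x * re_dif x t + im_dif x t) / 2"
  "im_dif x (2 * t) = (im_dif x t + (vers x * im_mid x t - sin x * re_dif x t)) / 2"
  unfolding mid_dif_defs gam_next vers_def by (simp_all add: field_simps)

lemma step_odd:
  "re_mid x (2 * t + 1) = ((2 - vers x) * re_mid x t - re_dif x t - sin x * im_dif x t) / 2"
  "re_dif x (2 * t + 1) = (re_dif x t - (vers x * re_mid x t + sin x * im_dif x t)) / 2"
  "im_mid x (2 * t + 1) = ((2 - vers x) * im_mid x t + sin x * re_dif x t - im_dif x t) / 2"
  "im_dif x (2 * t + 1) = (im_dif x t - (vers x * im_mid x t - sin x * re_dif x t)) / 2"
  unfolding mid_dif_defs gam_next vers_def by (simp_all add: field_simps)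

lemma sin_sq_vers: "(sin x)\<^sup>2 = vers x * (2 - vers x)" for x :: real
  using sin_cos_squared_add[of x] by (simp add: vers_def power2_eq_square algebra_simps)

lemma vers_bounds: "0 \<le> vers x" "vers x \<le> 2" for x :: real
  using cos_ge_minus_one[of x] by (simp_all add: vers_def)


lemma gam_1_parts:
  "Re (gam x 1) = 1 - 2 * (vers x * (1 + vers x) / (1 + 4 * vers x))"
  "Im (gam x 1) = 2 * (sin x * vers x / (1 + 4 * vers x))"
proof -
  have pos: "1 + 4 * vers x > 0" using vers_bounds[of x] by linarith
  have "gam x 1 * (2 - cis (-x)) = cis x"
    unfolding gam_1 using two_minus_cis_nonzero[of "-x"] by simp
  then have eqs: "Re (gam x 1) * (1 + vers x) - Im (gam x 1) * sin x = 1 - vers x"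
    "Im (gam x 1) * (1 + vers x) + Re (gam x 1) * sin x = sin x"
    by (simp_all add: complex_eq_iff vers_def)
  have s: "sin x * sin x = vers x * (2 - vers x)"
    using sin_sq_vers[of x] by (simp add: power2_eq_square)
  have "Re (gam x 1) * (1 + 4 * vers x) = 1 + 4 * vers x - 2 * (vers x * (1 + vers x))"
    using eqs s by algebra
  then show "Re (gam x 1) = 1 - 2 * (vers x * (1 + vers x) / (1 + 4 * vers x))"
    using pos by (simp add: field_simps)
  have "Im (gam x 1) * (1 + 4 * vers x) = 2 * (sin x * vers x)"
    using eqs s by algebra
  then show "Im (gam x 1) = 2 * (sin x * vers x / (1 + 4 * vers x))"
    using pos by (simp add: field_simps)
qed

lemma mid_dif_0:
  "re_dif x 0 = vers x * (1 + vers x) / (1 + 4 * vers x)"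
  "re_mid x 0 = 1 - re_dif x 0"
  "im_mid x 0 = sin x * vers x / (1 + 4 * vers x)"
  "im_dif x 0 = - (sin x * vers x / (1 + 4 * vers x))"
proof -
  define q r where "q = vers x * (1 + vers x) / (1 + 4 * vers x)"
    and "r = sin x * vers x / (1 + 4 * vers x)"
  have "Re (gam x (0 + 1)) = 1 - 2 * q" "Im (gam x (0 + 1)) = 2 * r"
    unfolding q_def r_def add_0 by (rule gam_1_parts)+
  then show "re_dif x 0 = vers x * (1 + vers x) / (1 + 4 * vers x)" "re_mid x 0 = 1 - re_dif x 0"
    "im_mid x 0 = sin x * vers x / (1 + 4 * vers x)" "im_dif x 0 = - (sin x * vers x / (1 + 4 * vers x))"
    unfolding mid_dif_defs q_def[symmetric] r_def[symmetric] gam_0 by (simp_all add: field_simps)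
qed

lemma mid_dif_0_bounds:
  "0 \<le> re_dif x 0" "re_dif x 0 \<le> vers x" "re_dif x 0 \<le> 1"
  "\<bar>im_mid x 0\<bar> \<le> \<bar>sin x\<bar> * vers x" "\<bar>im_dif x 0\<bar> \<le> \<bar>sin x\<bar> * vers x"
proof -
  note k = vers_bounds[of x]
  show "0 \<le> re_dif x 0" unfolding mid_dif_0 using k by simp
  have "vers x * (1 + vers x) \<le> vers x * (1 + 4 * vers x)"
    using k by (intro mult_left_mono) auto
  then show "re_dif x 0 \<le> vers x"
    unfolding mid_dif_0 using k by (subst pos_divide_le_eq) auto
  have "vers x * vers x \<le> 2 * vers x" using k by (intro mult_right_mono) auto
  then have "vers x * (1 + vers x) \<le> 1 + 4 * vers x" using k unfolding distrib_left by linarith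
  then show "re_dif x 0 \<le> 1"
    unfolding mid_dif_0 using k by (subst pos_divide_le_eq) auto
  have "\<bar>sin x\<bar> * vers x / (1 + 4 * vers x) \<le> \<bar>sin x\<bar> * vers x / 1"
    using k by (intro divide_left_mono) auto
  then show "\<bar>im_mid x 0\<bar> \<le> \<bar>sin x\<bar> * vers x" "\<bar>im_dif x 0\<bar> \<le> \<bar>sin x\<bar> * vers x"
    unfolding mid_dif_0 using k by (simp_all add: abs_mult)
qed

text \<open>Weighted inequality of arithmetic and geometric means; the condition on \<open>b\<close>
  is the discriminant condition for a quadratic form.\<close>

lemma cross_term_le:
  fixes X Y h b p q :: real
  assumes "h\<^sup>2 \<le> X * Y" "b\<^sup>2 \<le> 4 * p * q" "X \<ge> 0" "Y \<ge> 0" "p \<ge> 0" "q \<ge> 0"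
  shows "b * h \<le> p * X + q * Y"
proof (rule power2_le_imp_le)
  have "(b * h)\<^sup>2 \<le> (4 * p * q) * (X * Y)"
    unfolding power_mult_distrib using assms by (intro mult_mono) auto
  also have "\<dots> \<le> (p * X + q * Y)\<^sup>2"
    using zero_le_power2[of "p * X - q * Y"] by (simp add: power2_eq_square algebra_simps)
  finally show "(b * h)\<^sup>2 \<le> (p * X + q * Y)\<^sup>2" .
qed (use assms in simp)

section \<open>Quadratic moments of the pair and contraction of the energy\<close>

definition mid_sq :: "real \<Rightarrow> nat \<Rightarrow> real" where
  "mid_sq x t = (re_mid x t)\<^sup>2 + (im_mid x t)\<^sup>2"
definition dif_sq :: "real \<Rightarrow> nat \<Rightarrow> real" where
  "dif_sq x t = (re_dif x t)\<^sup>2 + (im_dif x t)\<^sup>2"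
text \<open>The imaginary part of conj(mid) * dif for the complex half sum and half difference. The
  real part of this product changes sign with the digit and averages out, so the recursion closes on
  three moments.\<close>

definition mid_dif_cross :: "real \<Rightarrow> nat \<Rightarrow> real" where
  "mid_dif_cross x t = re_mid x t * im_dif x t - im_mid x t * re_dif x t"

lemmas moment_defs = mid_sq_def dif_sq_def mid_dif_cross_def

lemma moment_nonneg: "0 \<le> mid_sq x t" "0 \<le> dif_sq x t"
  by (simp_all add: moment_defs)

text \<open>Lagrange's identity: the gap is the square of the real part of conj(mid) * dif.\<close>

lemma cross_sq_le: "(mid_dif_cross x t)\<^sup>2 \<le> mid_sq x t * dif_sq x t"
  unfolding moment_defs using zero_le_power2[of "re_mid x t * re_dif x t + im_mid x t * im_dif x t"]
  by (simp add: power2_eq_square algebra_simps)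

lemma avg_mid_sq_Suc:
  "avg (Suc n) (mid_sq x) = ((2 - vers x)\<^sup>2 * avg n (mid_sq x)
     - 2 * (2 - vers x) * sin x * avg n (mid_dif_cross x) + ((sin x)\<^sup>2 + 1) * avg n (dif_sq x)) / 4"
  unfolding avg_Suc avg_linear[symmetric] moment_defs step_even step_odd
  by (rule avg_cong) (simp add: power2_eq_square field_simps)

lemma avg_dif_sq_Suc:
  "avg (Suc n) (dif_sq x) = ((1 + (sin x)\<^sup>2) * avg n (dif_sq x)
     + (vers x)\<^sup>2 * avg n (mid_sq x) + 2 * vers x * sin x * avg n (mid_dif_cross x)) / 4"
  unfolding avg_Suc avg_linear[symmetric] moment_defs step_even step_odd
  by (rule avg_cong) (simp add: power2_eq_square field_simps)

lemma avg_cross_Suc: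
  "avg (Suc n) (mid_dif_cross x) = ((1 - vers x) * avg n (mid_dif_cross x) - sin x * avg n (dif_sq x)) / 2"
  unfolding avg_Suc avg_linear[symmetric] moment_defs step_even step_odd
  by (rule avg_cong) (simp add: power2_eq_square field_simps)

lemma avg_cross_le:
  assumes "b\<^sup>2 \<le> 4 * p * q" "p \<ge> 0" "q \<ge> 0"
  shows "b * avg n (mid_dif_cross x) \<le> p * avg n (mid_sq x) + q * avg n (dif_sq x)"
  unfolding avg_linear[symmetric]
  by (rule avg_mono, rule cross_term_le[OF cross_sq_le assms(1) moment_nonneg assms(2,3)])

text \<open>By the parallelogram law this is the average of half the sum of the squared moduli of
  \<open>gam x t\<close> and \<open>gam x (t + 1)\<close>.\<close>

definition energy :: "nat \<Rightarrow> real \<Rightarrow> real" where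
  "energy n x = avg n (mid_sq x) + avg n (dif_sq x)"

text \<open>The loss of energy is a quadratic form in the moments whose discriminant is exactly 0,
  so one digit yields monotonicity and no more.\<close>

lemma energy_Suc_le: "energy (Suc n) x \<le> energy n x"
proof -
  let ?c = "cos x" and ?s = "sin x"
  have s: "?s\<^sup>2 = 1 - ?c\<^sup>2" using sin_cos_squared_add[of x] by linarith
  have "(-(?c * ?s))\<^sup>2 \<le> 4 * (?s\<^sup>2 / 2) * (?c\<^sup>2 / 2)" by (simp add: power_mult_distrib)
  from avg_cross_le[OF this] have "-(?c * ?s) * avg n (mid_dif_cross x)
      \<le> ?s\<^sup>2 / 2 * avg n (mid_sq x) + ?c\<^sup>2 / 2 * avg n (dif_sq x)"
    by simp
  then show ?thesis
    unfolding energy_def avg_mid_sq_Suc avg_dif_sq_Suc s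
    by (simp add: vers_def power2_eq_square field_simps)
qed

text \<open>One binary digit need not decrease the energy, but two digits contract it.\<close>

lemma energy_Suc_Suc_le: "energy (Suc (Suc n)) x \<le> (1 - vers x / 5) * energy n x"
proof -
  define c s where "c = cos x" and "s = sin x"
  have s: "s\<^sup>2 = 1 - c\<^sup>2" using sin_cos_squared_add[of x] unfolding c_def s_def by linarith
  have c: "-1 \<le> c" "c \<le> 1" by (simp_all add: c_def)
  have vers: "vers x = 1 - c" by (simp add: c_def vers_def)
  \<comment> \<open>These are the coefficients of the three moments in the defect:
    \<open>(1 - vers x / 5) * energy n x\<close> minus the energy two digits later equals
    \<open>p * X + q * Y\<close> minus \<open>b\<close> times the cross moment. It is nonnegative
    because the discriminant below has the right sign.\<close>
  define p q b where "p = (1 - c) * (20 * c\<^sup>2 + 35 * c + 17) / 40"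
    and "q = (2 - 12 * c + 15 * c\<^sup>2 + 20 * c ^ 3) / 40" and "b = s * (1 + c) * (1 - 4 * c) / 4"
  have disc: "4 * p * q - b\<^sup>2 = 9 * (1 - c)\<^sup>2 / 400"
  proof -
    have "b\<^sup>2 = (1 - c\<^sup>2) * (1 + c)\<^sup>2 * (1 - 4 * c)\<^sup>2 / 16"
      unfolding b_def power_divide power_mult_distrib s by simp
    then show ?thesis
      unfolding p_def q_def by (simp add: power2_eq_square power3_eq_cube field_simps)
  qed
  have quad: "20 * c\<^sup>2 + 35 * c + 17 > 0"
  proof -
    have "20 * c\<^sup>2 + 35 * c + 17 = 20 * (c + 7/8)\<^sup>2 + 27/16"
      by (simp add: power2_eq_square field_simps)
    then show ?thesis using zero_le_power2[of "c + 7/8"] by linarith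
  qed
  have p: "p \<ge> 0" unfolding p_def using quad c by simp
  \<comment> \<open>The sign of the cubic is read off from \<open>disc\<close> and the sign of
    \<open>p\<close>; only \<open>c = 1\<close>, where \<open>p\<close> vanishes, is evaluated
    directly.\<close>
  have q: "q \<ge> 0"
  proof (cases "c = 1")
    case False
    then have "p > 0" unfolding p_def using quad c by simp
    moreover have "4 * p * q \<ge> 0" using disc zero_le_power2[of b] zero_le_power2[of "1 - c"] by linarith
    ultimately show ?thesis by (simp add: zero_le_mult_iff)
  qed (simp add: q_def)
  have "b\<^sup>2 \<le> 4 * p * q" using disc zero_le_power2[of "1 - c"] by linarith
  from avg_cross_le[OF this p q]
  have le: "b * avg n (mid_dif_cross x) \<le> p * avg n (mid_sq x) + q * avg n (dif_sq x)" .
  define X Y w where "X m = avg m (mid_sq x)" and "Y m = avg m (dif_sq x)"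
    and "w m = s * avg m (mid_dif_cross x)" for m
  have X_Suc: "X (Suc m) = ((1 + c)\<^sup>2 * X m - 2 * (1 + c) * w m + (2 - c\<^sup>2) * Y m) / 4"
    and Y_Suc: "Y (Suc m) = ((2 - c\<^sup>2) * Y m + (1 - c)\<^sup>2 * X m + 2 * (1 - c) * w m) / 4" for m
    unfolding X_def Y_def w_def avg_mid_sq_Suc avg_dif_sq_Suc vers s_def[symmetric] s by simp_all
  have w_Suc: "w (Suc m) = (c * w m - (1 - c\<^sup>2) * Y m) / 2" for m
    unfolding X_def Y_def w_def avg_cross_Suc vers s_def[symmetric] s[symmetric]
    by (simp add: power2_eq_square algebra_simps)
  have "energy (Suc (Suc n)) x = X (Suc (Suc n)) + Y (Suc (Suc n))"
    by (simp add: energy_def X_def Y_def)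
  also have "\<dots> = (1 - vers x / 5) * (X n + Y n) - p * X n - q * Y n + (1 + c) * (1 - 4 * c) / 4 * w n"
    unfolding X_Suc Y_Suc w_Suc vers p_def q_def
    by (simp add: power2_eq_square power3_eq_cube field_simps)
  also have "(1 + c) * (1 - 4 * c) / 4 * w n = b * avg n (mid_dif_cross x)"
    by (simp add: b_def w_def)
  finally show ?thesis using le unfolding energy_def X_def Y_def by linarith
qed

text \<open>The two-digit contraction would permit \<open>1 - vers x / 10\<close>. The slower decay
  keeps the rate at least 9/10, which later absorbs numerical constants.\<close>

abbreviation rate :: "real \<Rightarrow> real" where
  "rate x \<equiv> 1 - vers x / 20"

lemma rate_bounds: "9/10 \<le> rate x" "rate x \<le> 1"
  using vers_bounds[of x] by simp_all

text \<open>The induction advances by two digits. The factor 2 covers the start n = 1, where only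
  monotonicity is available.\<close>

lemma energy_le: "energy n x \<le> 2 * rate x ^ n"
proof (induction n rule: less_induct)
  case (less n)
  note k = vers_bounds[of x]
  have e0: "energy 0 x \<le> 1"
  proof -
    have pos: "1 + 4 * vers x > 0" using k by linarith
    have "norm (gam x 1) \<le> 1"
    proof -
      have "norm (2 - cis (-x)) \<ge> 1" using norm_triangle_ineq2[of 2 "cis (-x)"] by simp
      then show ?thesis unfolding gam_1 norm_divide by (auto simp: divide_le_eq)
    qed
    then have "(norm (gam x 1))\<^sup>2 \<le> 1" by (simp add: power_le_one)
    then have "(Re (gam x 1))\<^sup>2 + (Im (gam x 1))\<^sup>2 \<le> 1" unfolding cmod_power2 .
    then show ?thesis
      unfolding energy_def avg_0 moment_defs mid_dif_defs
      by (simp add: gam_0 power2_eq_square field_simps)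
  qed
  consider "n = 0" | "n = 1" | m where "n = Suc (Suc m)"
    by (metis One_nat_def not0_implies_Suc)
  then show ?case
  proof cases
    case 1 then show ?thesis using e0 by simp
  next
    case 2 then show ?thesis using e0 energy_Suc_le[of 0 x] rate_bounds[of x] by simp
  next
    case (3 m)
    have "(1 - vers x / 5) \<le> rate x * rate x" using k by (simp add: algebra_simps)
    moreover have "energy m x \<ge> 0" unfolding energy_def using moment_nonneg by (simp add: avg_nonneg)
    ultimately have "energy n x \<le> (rate x * rate x) * energy m x"
      using energy_Suc_Suc_le[of m x] mult_right_mono unfolding 3 by (metis order_trans)
    also have "\<dots> \<le> (rate x * rate x) * (2 * rate x ^ m)"
      using less[of m] 3 by (intro mult_left_mono) auto
    finally show ?thesis unfolding 3 by (simp add: mult_ac)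
  qed
qed

text \<open>On its own the squared difference shrinks by 3/4 per digit, and \<open>mid_sq\<close>
  feeds it with a factor \<open>(vers x)^2\<close>. As 3/4 lies strictly below the rate of the
  source, there is no resonance and no factor n.\<close>

lemma avg_dif_sq_le: "avg n (dif_sq x) \<le> 7 * (vers x)\<^sup>2 * rate x ^ n"
proof (induction n)
  case 0
  note k = vers_bounds[of x]
  have pos: "1 + 4 * vers x \<ge> 1" using k by linarith
  have "dif_sq x 0 = (vers x)\<^sup>2 * ((1 + vers x)\<^sup>2 + (sin x)\<^sup>2) / (1 + 4 * vers x)\<^sup>2"
  proof -
    have "(a * b / w)\<^sup>2 + (- (u * a / w))\<^sup>2 = a\<^sup>2 * (b\<^sup>2 + u\<^sup>2) / w\<^sup>2" for a b u w :: real
      by (simp add: power_divide power_mult_distrib add_divide_distrib distrib_left mult.commute)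
    then show ?thesis unfolding moment_defs mid_dif_0 .
  qed
  also have "(1 + vers x)\<^sup>2 + (sin x)\<^sup>2 = 1 + 4 * vers x"
    unfolding sin_sq_vers by (simp add: power2_eq_square algebra_simps)
  also have "(vers x)\<^sup>2 * (1 + 4 * vers x) / (1 + 4 * vers x)\<^sup>2 = (vers x)\<^sup>2 / (1 + 4 * vers x)"
    using pos by (simp add: power2_eq_square)
  also have "\<dots> \<le> (vers x)\<^sup>2 / 1" using pos by (intro divide_left_mono) auto
  finally have "dif_sq x 0 \<le> (vers x)\<^sup>2" by simp
  then show ?case using zero_le_power2[of "vers x"] unfolding avg_0 power_0 by linarith
next
  case (Suc n)
  let ?k = "vers x" and ?s = "sin x" and ?r = "rate x ^ n"
  have s: "?s\<^sup>2 \<le> 1" by (simp add: abs_square_le_1)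
  have "(?k * ?s / 2)\<^sup>2 \<le> 4 * (?k\<^sup>2 / 4) * (?s\<^sup>2 / 4)" by (simp add: power_mult_distrib power_divide)
  from avg_cross_le[OF this] have cross: "?k * ?s / 2 * avg n (mid_dif_cross x)
      \<le> ?k\<^sup>2 / 4 * avg n (mid_sq x) + ?s\<^sup>2 / 4 * avg n (dif_sq x)" by simp
  have nn: "0 \<le> avg n (dif_sq x)" "0 \<le> avg n (mid_sq x)" by (simp_all add: avg_nonneg moment_nonneg)
  have "avg n (mid_sq x) \<le> 2 * ?r"
    using energy_le[of n x] nn unfolding energy_def by linarith
  then have mid: "?k\<^sup>2 * avg n (mid_sq x) \<le> ?k\<^sup>2 * (2 * ?r)" by (intro mult_left_mono) auto
  have dif: "?s\<^sup>2 * avg n (dif_sq x) \<le> 1 * avg n (dif_sq x)" using s nn by (intro mult_right_mono)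
  have "avg (Suc n) (dif_sq x) \<le> 3/4 * avg n (dif_sq x) + ?k\<^sup>2 * avg n (mid_sq x) / 2"
    unfolding avg_dif_sq_Suc using cross dif by (simp add: field_simps)
  also have "\<dots> \<le> 3/4 * (7 * ?k\<^sup>2 * ?r) + ?k\<^sup>2 * ?r" using Suc mid by linarith
  also have "\<dots> = (25/4) * (?k\<^sup>2 * ?r)" by simp
  \<comment> \<open>The constant 7 is chosen so that \<open>3/4 * 7 + 1 = 25/4\<close> is at most
    \<open>7 * (9/10)\<close>.\<close>
  also have "\<dots> \<le> (7 * rate x) * (?k\<^sup>2 * ?r)"
    using rate_bounds[of x] by (intro mult_right_mono mult_nonneg_nonneg) auto
  finally show ?case by (simp only: power_Suc mult_ac)
qed

section \<open>Mean squares of the real and imaginary parts\<close>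

lemma sum_square_le: "(a + b)\<^sup>2 \<le> 2 * a\<^sup>2 + 2 * b\<^sup>2" for a b :: real
  using zero_le_power2[of "a - b"] by (simp add: power2_eq_square algebra_simps)

lemma abs_sum4_div4_le: "\<bar>(a + b + c + d) / 4\<bar> \<le> (\<bar>a\<bar> + \<bar>b\<bar> + \<bar>c\<bar> + \<bar>d\<bar>) / 4" for a b c d :: real
proof -
  have "\<bar>a + b + c + d\<bar> \<le> \<bar>a\<bar> + \<bar>b\<bar> + \<bar>c\<bar> + \<bar>d\<bar>"
    by (intro order_trans[OF abs_triangle_ineq] add_mono order_refl)
  then show ?thesis by simp
qed

text \<open>With u = \<open>1 - vers x / 2\<close>, a digit turns the deviation p into
  \<open>u * p - sin x * im_dif x t / 2\<close> plus or minus \<open>re_dif x t / 2\<close>. The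
  differences are already known to be of order \<open>vers x\<close> in mean square.\<close>

lemma avg_re_mid_dev_le:
  "avg n (\<lambda>t. (re_mid x t - (1 - vers x / 2) ^ n)\<^sup>2) \<le> ((vers x)\<^sup>2 + n * (16 * (vers x)\<^sup>2)) * rate x ^ n"
proof (rule geometric_bound)
  note k = vers_bounds[of x]
  have "(re_dif x 0)\<^sup>2 \<le> (vers x)\<^sup>2"
    using mid_dif_0_bounds[of x] by (intro power_mono) auto
  then show "avg 0 (\<lambda>t. (re_mid x t - (1 - vers x / 2) ^ 0)\<^sup>2) \<le> (vers x)\<^sup>2"
    by (simp add: avg_0 mid_dif_0(2))
  show "0 \<le> rate x" using rate_bounds[of x] by linarith
  fix n
  let ?u = "1 - vers x / 2" and ?p = "\<lambda>t. re_mid x t - (1 - vers x / 2) ^ n"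
  have "((re_mid x (2 * t) - ?u ^ Suc n)\<^sup>2 + (re_mid x (2 * t + 1) - ?u ^ Suc n)\<^sup>2) / 2
      \<le> rate x * (?p t)\<^sup>2 + 2 * dif_sq x t" for t
  proof -
    define p d f u where "p = ?p t" and "d = re_dif x t" and "f = im_dif x t" and "u = ?u"
    have "re_mid x (2 * t) - ?u ^ Suc n = ?u * p - sin x * f / 2 + d / 2"
      "re_mid x (2 * t + 1) - ?u ^ Suc n = ?u * p - sin x * f / 2 - d / 2"
      unfolding step_even step_odd p_def d_def f_def by (simp_all add: field_simps)
    then have "((re_mid x (2 * t) - ?u ^ Suc n)\<^sup>2 + (re_mid x (2 * t + 1) - ?u ^ Suc n)\<^sup>2) / 2
      = ((u * p - sin x * f / 2 + d / 2)\<^sup>2 + (u * p - sin x * f / 2 - d / 2)\<^sup>2) / 2"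
      by (simp only: u_def)
    also have "\<dots> = u * (u * p\<^sup>2 + (- sin x) * (p * f)) + (sin x)\<^sup>2 * f\<^sup>2 / 4 + d\<^sup>2 / 4"
      by (simp add: power2_eq_square field_simps)
    also have "\<dots> = ?u * (?u * p\<^sup>2 + (- sin x) * (p * f)) + (sin x)\<^sup>2 * f\<^sup>2 / 4 + d\<^sup>2 / 4"
      by (simp only: u_def)
    \<comment> \<open>The cross term spends part of the contraction: the squared sine is at most
      \<open>2 * vers x\<close>, and \<open>?u * (?u + vers x / 2) = ?u\<close>, which is still
      below the rate.\<close>
    also have "\<dots> \<le> ?u * (?u * p\<^sup>2 + (vers x / 2 * p\<^sup>2 + 1 * f\<^sup>2)) + 1 * f\<^sup>2 / 4 + d\<^sup>2 / 4"
    proof (intro add_mono mult_left_mono divide_right_mono mult_right_mono order_refl)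
      show "- sin x * (p * f) \<le> vers x / 2 * p\<^sup>2 + 1 * f\<^sup>2"
      proof (rule cross_term_le)
        show "(- sin x)\<^sup>2 \<le> 4 * (vers x / 2) * 1"
          using k mult_nonneg_nonneg[OF k(1) k(1)] unfolding power2_minus sin_sq_vers
          by (simp add: algebra_simps)
      qed (use k in \<open>auto simp: power_mult_distrib\<close>)
      show "(sin x)\<^sup>2 \<le> 1" by (simp add: abs_square_le_1)
    qed (use k in auto)
    also have "\<dots> = ?u * p\<^sup>2 + (?u + 1/4) * f\<^sup>2 + d\<^sup>2 / 4"
      by (simp add: field_simps)
    also have "\<dots> \<le> rate x * p\<^sup>2 + 2 * f\<^sup>2 + 2 * d\<^sup>2"
      using k by (intro add_mono mult_right_mono) auto
    finally show ?thesis unfolding dif_sq_def p_def d_def f_def by simp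
  qed
  then have "avg (Suc n) (\<lambda>t. (re_mid x t - ?u ^ Suc n)\<^sup>2)
      \<le> avg n (\<lambda>t. rate x * (?p t)\<^sup>2 + 2 * dif_sq x t)"
    unfolding avg_Suc by (rule avg_mono)
  also have "\<dots> = rate x * avg n (\<lambda>t. (?p t)\<^sup>2) + 2 * avg n (dif_sq x)"
    by (simp only: avg_linear)
  \<comment> \<open>Since 14 is at most \<open>16 * (9/10)\<close>, the additional factor
    \<open>rate x\<close> in the form required by \<open>geometric_bound\<close> comes for
    free.\<close>
  also have "2 * avg n (dif_sq x) \<le> (16 * (9/10)) * ((vers x)\<^sup>2 * rate x ^ n)"
  proof -
    have "0 \<le> (vers x)\<^sup>2 * rate x ^ n" using rate_bounds[of x] by simp
    then show ?thesis using avg_dif_sq_le[of n x] by linarith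
  qed
  also have "\<dots> \<le> (16 * rate x) * ((vers x)\<^sup>2 * rate x ^ n)"
    using rate_bounds[of x] by (intro mult_right_mono mult_nonneg_nonneg) auto
  finally show "avg (Suc n) (\<lambda>t. (re_mid x t - ?u ^ Suc n)\<^sup>2)
      \<le> rate x * avg n (\<lambda>t. (?p t)\<^sup>2) + 16 * (vers x)\<^sup>2 * rate x ^ Suc n"
    by (simp only: power_Suc mult_ac)
qed

lemma avg_Re_gam_dev_le:
  "avg n (\<lambda>t. (Re (gam x t) - (1 - vers x / 2) ^ n)\<^sup>2) \<le> 32 * (real n + 1) * (vers x)\<^sup>2 * rate x ^ n"
proof -
  have "(Re (gam x t) - (1 - vers x / 2) ^ n)\<^sup>2
      \<le> 2 * (re_mid x t - (1 - vers x / 2) ^ n)\<^sup>2 + 2 * dif_sq x t" for t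
  proof -
    define p where "p = re_mid x t - (1 - vers x / 2) ^ n"
    have "Re (gam x t) - (1 - vers x / 2) ^ n = p + re_dif x t"
      by (simp add: p_def mid_dif_defs field_simps)
    show ?thesis
      unfolding \<open>Re (gam x t) - (1 - vers x / 2) ^ n = p + re_dif x t\<close> p_def[symmetric] dif_sq_def
      by (intro order_trans[OF sum_square_le[of p "re_dif x t"]]) simp
  qed
  then have "avg n (\<lambda>t. (Re (gam x t) - (1 - vers x / 2) ^ n)\<^sup>2)
      \<le> 2 * avg n (\<lambda>t. (re_mid x t - (1 - vers x / 2) ^ n)\<^sup>2) + 2 * avg n (dif_sq x)"
    unfolding avg_linear[symmetric] by (rule avg_mono)
  also have "\<dots> \<le> 2 * (((vers x)\<^sup>2 + n * (16 * (vers x)\<^sup>2)) * rate x ^ n) + 2 * (7 * (vers x)\<^sup>2 * rate x ^ n)"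
    by (intro add_mono mult_left_mono avg_re_mid_dev_le avg_dif_sq_le) auto
  also have "\<dots> = (16 + 32 * real n) * ((vers x)\<^sup>2 * rate x ^ n)"
    by (simp add: algebra_simps)
  also have "\<dots> \<le> (32 * (real n + 1)) * ((vers x)\<^sup>2 * rate x ^ n)"
    using rate_bounds[of x] by (intro mult_right_mono mult_nonneg_nonneg) auto
  finally show ?thesis by (simp only: mult_ac)
qed

text \<open>\<open>mid_dif_mean\<close> minus this is the average of \<open>mid_dif_cross\<close>.
  The two are kept apart because the moments of the imaginary parts couple directly to this one
  alone, while \<open>mid_sq\<close> contains the real part and carries no power of
  \<open>vers x\<close>.\<close>

definition dif_mid_mean :: "nat \<Rightarrow> real \<Rightarrow> real" where
  "dif_mid_mean n x = avg n (\<lambda>t. re_dif x t * im_mid x t)"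
definition mid_dif_mean :: "nat \<Rightarrow> real \<Rightarrow> real" where
  "mid_dif_mean n x = avg n (\<lambda>t. re_mid x t * im_dif x t)"

abbreviation im_mid_sq :: "nat \<Rightarrow> real \<Rightarrow> real" where
  "im_mid_sq n x \<equiv> avg n (\<lambda>t. (im_mid x t)\<^sup>2)"
abbreviation im_dif_sq :: "nat \<Rightarrow> real \<Rightarrow> real" where
  "im_dif_sq n x \<equiv> avg n (\<lambda>t. (im_dif x t)\<^sup>2)"
abbreviation re_dif_sq :: "nat \<Rightarrow> real \<Rightarrow> real" where
  "re_dif_sq n x \<equiv> avg n (\<lambda>t. (re_dif x t)\<^sup>2)"

lemma second_moments_Suc:
  "im_mid_sq (Suc n) x = ((2 - vers x)\<^sup>2 * im_mid_sq n x + 2 * (2 - vers x) * sin x * dif_mid_mean n x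
      + (sin x)\<^sup>2 * re_dif_sq n x + im_dif_sq n x) / 4"
  "im_dif_sq (Suc n) x = (im_dif_sq n x + (vers x)\<^sup>2 * im_mid_sq n x - 2 * vers x * sin x * dif_mid_mean n x
      + (sin x)\<^sup>2 * re_dif_sq n x) / 4"
  "dif_mid_mean (Suc n) x = ((2 - vers x) * dif_mid_mean n x + sin x * re_dif_sq n x
      + vers x * mid_dif_mean n x + sin x * im_dif_sq n x) / 4"
  "mid_dif_mean (Suc n) x = ((2 - vers x) * mid_dif_mean n x - sin x * im_dif_sq n x
      + vers x * dif_mid_mean n x - sin x * re_dif_sq n x) / 4"
  unfolding dif_mid_mean_def mid_dif_mean_def avg_Suc avg_linear[symmetric] step_even step_odd
  by (rule avg_cong, simp add: power2_eq_square field_simps)+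

text \<open>Cauchy-Schwarz is too weak for the correlations \<open>dif_mid_mean\<close> and
  \<open>mid_dif_mean\<close>, so they enter the Lyapunov function \<open>L\<close> with weights of their own.\<close>

lemma avg_im_small_vers:
  assumes small: "vers x \<le> 1/5" and s0: "sin x \<ge> 0"
  shows "im_mid_sq n x + im_dif_sq n x \<le> (14 * vers x ^ 3 + n * (24 * vers x ^ 3)) * rate x ^ n"
proof -
  define k s where "k = vers x" and "s = sin x"
  have k: "0 \<le> k" "k \<le> 1/5" using vers_bounds[of x] small by (simp_all add: k_def)
  have s: "0 \<le> s" using s0 by (simp add: s_def)
  have s2: "s\<^sup>2 = k * (2 - k)" unfolding s_def k_def by (rule sin_sq_vers)
  have s2_le: "s\<^sup>2 \<le> 2 * k" "s\<^sup>2 \<le> 2/5"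
  proof -
    have "k * (2 - k) \<le> k * 2" using k by (intro mult_left_mono) auto
    then show "s\<^sup>2 \<le> 2 * k" "s\<^sup>2 \<le> 2/5" unfolding s2 using k by linarith+
  qed
  have kk: "k * k \<le> k * (1/5)" using k by (intro mult_left_mono) auto
  have r: "rate x = 1 - k / 20" by (simp add: k_def)
  define G F B C H where "G n = im_mid_sq n x" and "F n = im_dif_sq n x" and "B n = re_dif_sq n x"
    and "C n = dif_mid_mean n x" and "H n = mid_dif_mean n x" for n
  note folds = k_def[symmetric] s_def[symmetric] G_def[symmetric] F_def[symmetric] B_def[symmetric]
      C_def[symmetric] H_def[symmetric]
  note rec = second_moments_Suc[of _ x, unfolded folds]
  have nn: "0 \<le> G n" "0 \<le> F n" "0 \<le> B n" for n
    unfolding G_def F_def B_def by (simp_all add: avg_nonneg)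
  \<comment> \<open>At n = 0 all four summands are of order \<open>k ^ 3\<close>. The weights 3 and
    2 leave room for the coupling: after one digit \<open>s * \<bar>C n\<bar>\<close> has a
    coefficient of at most 5/2, and \<open>k * s * \<bar>H n\<bar>\<close> one of at most
    7/4.\<close>
  define L where "L n = G n + F n + 3 * s * \<bar>C n\<bar> + 2 * k * s * \<bar>H n\<bar>" for n
  have "L n \<le> (14 * k ^ 3 + n * (24 * k ^ 3)) * rate x ^ n"
  proof (rule geometric_bound)
    show "0 \<le> rate x" using rate_bounds[of x] by linarith
    have sk: "(s * k)\<^sup>2 \<le> 2 * k ^ 3"
    proof -
      have "(s * k)\<^sup>2 = s\<^sup>2 * k\<^sup>2" by (rule power_mult_distrib)
      also have "\<dots> \<le> 2 * k * k\<^sup>2" using s2_le by (intro mult_right_mono) auto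
      finally show ?thesis by (simp add: power3_eq_cube power2_eq_square mult_ac)
    qed
    note q = mid_dif_0_bounds[of x, unfolded k_def[symmetric] s_def[symmetric]]
    have "(im_mid x 0)\<^sup>2 \<le> (s * k)\<^sup>2" "(im_dif x 0)\<^sup>2 \<le> (s * k)\<^sup>2"
      using q s k by (simp_all add: abs_le_square_iff[symmetric] abs_mult)
    then have GF: "G 0 \<le> 2 * k ^ 3" "F 0 \<le> 2 * k ^ 3"
      unfolding G_def F_def avg_0 using sk by linarith+
    have "s * \<bar>C 0\<bar> \<le> s * (k * (s * k))"
      unfolding C_def dif_mid_mean_def avg_0 abs_mult using q s k
      by (intro mult_left_mono mult_mono) auto
    also have "\<dots> = (s * k)\<^sup>2" by (simp add: power2_eq_square mult_ac)
    finally have C0: "s * \<bar>C 0\<bar> \<le> 2 * k ^ 3" using sk by linarith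
    have "\<bar>re_mid x 0\<bar> \<le> 1" unfolding mid_dif_0(2) using q by simp
    then have "k * s * \<bar>H 0\<bar> \<le> k * s * (1 * (s * k))"
      unfolding H_def mid_dif_mean_def avg_0 abs_mult using q s k
      by (intro mult_left_mono mult_mono) auto
    also have "\<dots> = (s * k)\<^sup>2" by (simp add: power2_eq_square mult_ac)
    finally have H0: "k * s * \<bar>H 0\<bar> \<le> 2 * k ^ 3" using sk by linarith
    \<comment> \<open>The four summands contribute
      \<open>2 + 2 + 3 * 2 + 2 * 2 = 14\<close>.\<close>
    show "L 0 \<le> 14 * k ^ 3" unfolding L_def using GF C0 H0 by linarith
    fix n
    have Cle: "\<bar>C (Suc n)\<bar> \<le> ((2 - k) * \<bar>C n\<bar> + s * B n + k * \<bar>H n\<bar> + s * F n) / 4"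
      unfolding rec(3) using abs_sum4_div4_le[of "(2 - k) * C n" "s * B n" "k * H n" "s * F n"] k s nn[of n]
      by (simp add: abs_mult)
    have Hle: "\<bar>H (Suc n)\<bar> \<le> ((2 - k) * \<bar>H n\<bar> + s * F n + k * \<bar>C n\<bar> + s * B n) / 4"
      unfolding rec(4) using abs_sum4_div4_le[of "(2 - k) * H n" "- (s * F n)" "k * C n" "- (s * B n)"] k s nn[of n]
      by (simp add: abs_mult)
    have Gle: "G (Suc n) \<le> ((2 - k)\<^sup>2 * G n + 2 * (2 - k) * s * \<bar>C n\<bar> + s\<^sup>2 * B n + F n) / 4"
    proof -
      have "2 * (2 - k) * s * C n \<le> 2 * (2 - k) * s * \<bar>C n\<bar>"
        using k s by (intro mult_left_mono) auto
      then show ?thesis unfolding rec(1) by (intro divide_right_mono add_mono) auto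
    qed
    have Fle: "F (Suc n) \<le> (F n + k\<^sup>2 * G n + 2 * k * s * \<bar>C n\<bar> + s\<^sup>2 * B n) / 4"
    proof -
      have "2 * k * s * (- C n) \<le> 2 * k * s * \<bar>C n\<bar>"
        using k s by (intro mult_left_mono) auto
      then show ?thesis unfolding rec(2) by simp
    qed
    have "L (Suc n) \<le> ((2 - k)\<^sup>2 * G n + 2 * (2 - k) * s * \<bar>C n\<bar> + s\<^sup>2 * B n + F n) / 4
        + (F n + k\<^sup>2 * G n + 2 * k * s * \<bar>C n\<bar> + s\<^sup>2 * B n) / 4
        + 3 * s * (((2 - k) * \<bar>C n\<bar> + s * B n + k * \<bar>H n\<bar> + s * F n) / 4)
        + 2 * k * s * (((2 - k) * \<bar>H n\<bar> + s * F n + k * \<bar>C n\<bar> + s * B n) / 4)"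
      unfolding L_def using k s by (intro add_mono mult_left_mono Cle Hle Gle Fle) auto
    also have "\<dots> = (1 - k + k * k / 2) * G n + (1/2 + (3 + 2 * k) * s\<^sup>2 / 4) * F n
        + (5/2 - 3/4 * k + k * k / 2) * (s * \<bar>C n\<bar>) + (7/4 - k / 2) * (k * s * \<bar>H n\<bar>)
        + (5 + 2 * k) / 4 * s\<^sup>2 * B n"
      by (simp add: power2_eq_square field_simps)
    also have "\<dots> \<le> rate x * G n + rate x * F n + (rate x * 3) * (s * \<bar>C n\<bar>)
        + (rate x * 2) * (k * s * \<bar>H n\<bar>) + 3 * k * B n"
    proof (intro add_mono mult_right_mono nn)
      show "1 - k + k * k / 2 \<le> rate x" unfolding r using k kk by linarith
      \<comment> \<open>Smallness of \<open>k\<close> is essential here: at \<open>k = 1\<close> the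
        coefficient of \<open>F n\<close> would be 7/4.\<close>
      have "(3 + 2 * k) * s\<^sup>2 \<le> (17/5) * (2/5)"
        using k s2_le by (intro mult_mono) auto
      then show "1/2 + (3 + 2 * k) * s\<^sup>2 / 4 \<le> rate x" unfolding r using k by linarith
      have "5/2 - 3/4 * k + k * k / 2 \<le> 5/2" using k kk by linarith
      also have "\<dots> \<le> rate x * 3" unfolding r using k by (simp add: left_diff_distrib)
      finally show "5/2 - 3/4 * k + k * k / 2 \<le> rate x * 3" .
      show "7/4 - k / 2 \<le> rate x * 2" unfolding r using k by (simp add: left_diff_distrib)
      have "(5 + 2 * k) / 4 * s\<^sup>2 \<le> 3/2 * (2 * k)" using k s2_le by (intro mult_mono) auto
      then show "(5 + 2 * k) / 4 * s\<^sup>2 \<le> 3 * k" by linarith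
    qed (use k s in auto)
    also have "\<dots> = rate x * L n + 3 * k * B n" unfolding L_def by (simp add: algebra_simps)
    also have "3 * k * B n \<le> 3 * k * (7 * k\<^sup>2 * rate x ^ n)"
    proof (rule mult_left_mono)
      have "B n \<le> avg n (dif_sq x)" unfolding B_def dif_sq_def by (rule avg_mono) simp
      with avg_dif_sq_le[of n x] show "B n \<le> 7 * k\<^sup>2 * rate x ^ n" unfolding k_def by linarith
    qed (use k in simp)
    also have "\<dots> = 21 * (k ^ 3 * rate x ^ n)" by (simp add: power3_eq_cube power2_eq_square)
    also have "\<dots> \<le> (24 * rate x) * (k ^ 3 * rate x ^ n)"
      using k rate_bounds[of x] by (intro mult_right_mono mult_nonneg_nonneg) (auto simp: r)
    finally show "L (Suc n) \<le> rate x * L n + 24 * k ^ 3 * rate x ^ Suc n"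
      by (simp only: power_Suc mult_ac)
  qed
  moreover have "G n + F n \<le> L n" unfolding L_def using k s by simp
  ultimately show ?thesis unfolding G_def F_def k_def by linarith
qed

text \<open>Away from x = 0 the cube of \<open>vers x\<close> is bounded below, and the energy bound
  suffices. Only near 0 is the finer system of moments needed.\<close>

lemma avg_Im_gam_sq_le:
  assumes s0: "sin x \<ge> 0"
  shows "avg n (\<lambda>t. (Im (gam x t))\<^sup>2) \<le> 500 * (real n + 1) * vers x ^ 3 * rate x ^ n"
proof -
  note k = vers_bounds[of x]
  have k3: "0 \<le> vers x ^ 3 * rate x ^ n" using k rate_bounds[of x] by simp
  have "Im (gam x t) = im_mid x t + im_dif x t" for t by (simp add: mid_dif_defs field_simps)
  then have "avg n (\<lambda>t. (Im (gam x t))\<^sup>2) \<le> avg n (\<lambda>t. 2 * (im_mid x t)\<^sup>2 + 2 * (im_dif x t)\<^sup>2)"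
    by (intro avg_mono) (simp only: sum_square_le)
  also have "\<dots> = 2 * (im_mid_sq n x + im_dif_sq n x)" by (simp only: avg_linear distrib_left)
  also have "\<dots> \<le> (500 * (real n + 1)) * (vers x ^ 3 * rate x ^ n)"
  proof (cases "vers x \<le> 1/5")
    case True
    have "2 * (im_mid_sq n x + im_dif_sq n x) \<le> (28 + 48 * real n) * (vers x ^ 3 * rate x ^ n)"
      using avg_im_small_vers[OF True s0, of n] by (simp add: algebra_simps)
    also have "\<dots> \<le> (500 * (real n + 1)) * (vers x ^ 3 * rate x ^ n)"
      using k3 by (intro mult_right_mono) auto
    finally show ?thesis .
  next
    case False
    have "im_mid_sq n x \<le> avg n (mid_sq x)" "im_dif_sq n x \<le> avg n (dif_sq x)"
      unfolding moment_defs by (intro avg_mono; simp)+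
    then have "2 * (im_mid_sq n x + im_dif_sq n x) \<le> 2 * energy n x"
      unfolding energy_def by (intro mult_left_mono add_mono) auto
    also have "\<dots> \<le> 2 * (2 * rate x ^ n)" by (intro mult_left_mono energy_le) simp
    also have "\<dots> = 4 * rate x ^ n" by simp
    also have "\<dots> \<le> (500 * vers x ^ 3) * rate x ^ n"
    proof (rule mult_right_mono)
      \<comment> \<open>The constant 500 is \<open>4 * 5 ^ 3\<close>.\<close>
      have "(1/5) ^ 3 \<le> vers x ^ 3" using False by (intro power_mono) auto
      then show "4 \<le> 500 * vers x ^ 3" by (simp add: power3_eq_cube)
    qed (use rate_bounds[of x] in simp)
    also have "\<dots> \<le> (500 * (real n + 1)) * (vers x ^ 3 * rate x ^ n)"
      using k3 mult_right_mono[of 500 "500 * (real n + 1)" "vers x ^ 3 * rate x ^ n"] by (simp add: mult_ac)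
    finally show ?thesis .
  qed
  finally show ?thesis by (simp only: mult_ac)
qed

section \<open>Integration and exceptional sets\<close>

text \<open>Jordan's inequality gives \<open>2 * (x / pi)^2\<close> as a lower bound for
  \<open>vers x\<close>. Hence \<open>wt n\<close> dominates \<open>1 / (1 + n * vers x)\<close> on
  \<open>{0..pi}\<close>, and its antiderivative is an arctangent.\<close>

definition wt :: "nat \<Rightarrow> real \<Rightarrow> real" where
  "wt n x = 1 / (1 + 2 * real n * (x / pi)\<^sup>2)"

lemma wt_pos: "0 < wt n x"
  unfolding wt_def by (intro divide_pos_pos add_pos_nonneg) auto

lemma wt_le_1: "wt n x \<le> 1"
  unfolding wt_def by (subst divide_le_eq_1_pos) (auto intro!: add_pos_nonneg)

lemma continuous_on_wt: "continuous_on A (wt n)"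
  unfolding wt_def[abs_def]
  by (intro continuous_intros) (auto simp: add_nonneg_eq_0_iff)

lemma measurable_wt [measurable]: "wt n \<in> borel_measurable borel"
  by (rule borel_measurable_continuous_onI[OF continuous_on_wt])

lemma integrable_wt: "integrable half_circle (wt n)"
  by (rule integrable_half_circle_bounded[of _ 1]) (use wt_pos wt_le_1 in \<open>auto simp: less_imp_le\<close>)

lemma integral_wt_pos_le:
  assumes "n > 0"
  shows "0 < (LINT x|half_circle. wt n x)" "(LINT x|half_circle. wt n x) \<le> pi\<^sup>2 / sqrt n"
proof -
  define r where "r = sqrt (2 * real n)"
  have r: "r > 0" "r\<^sup>2 = 2 * real n" using assms by (simp_all add: r_def)
  have "(LINT x|half_circle. wt n x) = pi / r * arctan (r * pi / pi) - pi / r * arctan (r * 0 / pi)"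
  proof (rule integral_half_circle_FTC)
    fix x
    have "1 + (r * x / pi)\<^sup>2 = 1 + 2 * real n * (x / pi)\<^sup>2"
      unfolding power_divide power_mult_distrib r(2) by simp
    then have "wt n x = pi / r * (inverse (1 + (r * x / pi)\<^sup>2) * (r / pi))"
      using r unfolding wt_def inverse_eq_divide by simp
    moreover have "((\<lambda>x. pi / r * arctan (r * x / pi)) has_real_derivative
        pi / r * (inverse (1 + (r * x / pi)\<^sup>2) * (r / pi))) (at x)"
      by (auto intro!: derivative_eq_intros)
    ultimately show "((\<lambda>x. pi / r * arctan (r * x / pi)) has_real_derivative wt n x) (at x)"
      by simp
  qed (rule continuous_on_wt)
  then have eq: "(LINT x|half_circle. wt n x) = pi / r * arctan r" by simp
  show "0 < (LINT x|half_circle. wt n x)" unfolding eq using r by simp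
  have "pi / r * arctan r \<le> pi / r * pi"
  proof (rule mult_left_mono)
    show "arctan r \<le> pi" using arctan_ubound[of r] pi_gt_zero by linarith
  qed (use r in simp)
  also have "\<dots> = pi\<^sup>2 / r" by (simp add: power2_eq_square)
  also have "\<dots> \<le> pi\<^sup>2 / sqrt n"
    using assms by (intro divide_left_mono) (auto simp: r_def)
  finally show "(LINT x|half_circle. wt n x) \<le> pi\<^sup>2 / sqrt n" unfolding eq .
qed

lemma vers_half: "vers x = 2 * (sin (x / 2))\<^sup>2"
  using cos_double_sin[of "x / 2"] by (simp add: vers_def)

lemma vers_ge:
  assumes "0 \<le> x" "x \<le> pi" shows "2 * (x / pi)\<^sup>2 \<le> vers x"
  unfolding vers_half using sin_half_ge[OF assms] assms by (intro mult_left_mono power_mono) auto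

lemma vers_le: "vers x \<le> x\<^sup>2 / 2"
proof -
  have "(sin (x / 2))\<^sup>2 \<le> (x / 2)\<^sup>2"
    using abs_sin_x_le_abs_x[of "x / 2"] by (simp only: abs_le_square_iff)
  then show ?thesis unfolding vers_half by (simp add: power_divide)
qed

lemma inverse_vers_le_wt:
  assumes "0 \<le> x" "x \<le> pi" shows "1 / (1 + real n * vers x) \<le> wt n x"
proof -
  have "2 * real n * (x / pi)\<^sup>2 \<le> real n * vers x"
    using mult_left_mono[OF vers_ge[OF assms], of "real n"] by (simp add: mult_ac)
  then show ?thesis
    unfolding wt_def using vers_bounds[of x] by (intro divide_left_mono mult_pos_pos add_pos_nonneg) auto
qed

lemma rate_power_le: "rate x ^ n \<le> exp (- (real n * vers x / 20))"
proof -
  have "rate x \<le> exp (- (vers x / 20))" using exp_ge_add_one_self[of "- (vers x / 20)"] by simp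
  then have "rate x ^ n \<le> exp (- (vers x / 20)) ^ n"
    using rate_bounds[of x] by (intro power_mono) auto
  also have "\<dots> = exp (- (real n * vers x / 20))" by (simp add: exp_of_nat_mult[symmetric])
  finally show ?thesis .
qed

text \<open>With \<open>y = n * vers x\<close> the left side is at most
  \<open>2 / n * y^2 * rate x ^ n\<close>. The exponential decay in y pays for \<open>y^2\<close>
  and for the two factors \<open>1 + y\<close> in the denominator of the squared weight.\<close>

lemma moment_le_wt:
  assumes x: "0 \<le> x" "x \<le> pi" and n: "n > 0"
  shows "(real n + 1) * (vers x)\<^sup>2 * rate x ^ n \<le> 2 * 80 ^ 4 / real n * (wt n x)\<^sup>2"
proof -
  define y where "y = real n * vers x"
  have y: "y \<ge> 0" using vers_bounds[of x] by (simp add: y_def)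
  \<comment> \<open>80 is \<open>4 * 20\<close>: each of four factors \<open>1 + y\<close> uses up a
    quarter of the decay \<open>exp (- y / 20)\<close>.\<close>
  have "1 + y \<le> 80 * exp (y / 80)"
    using exp_ge_add_one_self[of "y / 80"] by linarith
  then have "(1 + y) ^ 4 \<le> (80 * exp (y / 80)) ^ 4"
    using y by (intro power_mono) auto
  also have "\<dots> = 80 ^ 4 * exp (y / 20)"
    unfolding power_mult_distrib by (simp add: exp_of_nat_mult[symmetric])
  finally have "(1 + y) ^ 4 * exp (- (y / 20)) \<le> 80 ^ 4"
    by (simp add: exp_minus field_simps)
  moreover have "(1 + y) ^ 4 * rate x ^ n \<le> (1 + y) ^ 4 * exp (- (y / 20))"
    using rate_power_le[of x n] y by (intro mult_left_mono) (auto simp: y_def)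
  ultimately have A: "(1 + y) ^ 4 * rate x ^ n \<le> 80 ^ 4" by linarith
  have r: "0 \<le> rate x ^ n" using rate_bounds[of x] by simp
  have "(real n + 1) * (vers x)\<^sup>2 * rate x ^ n * (real n * (1 + y)\<^sup>2)
      \<le> (2 * real n) * (vers x)\<^sup>2 * rate x ^ n * (real n * (1 + y)\<^sup>2)"
    using n r by (intro mult_right_mono) auto
  also have "\<dots> = 2 * (y\<^sup>2 * (1 + y)\<^sup>2 * rate x ^ n)"
    by (simp only: y_def power2_eq_square mult_ac)
  also have "\<dots> \<le> 2 * ((1 + y)\<^sup>2 * (1 + y)\<^sup>2 * rate x ^ n)"
    using y r by (intro mult_left_mono mult_right_mono power_mono) auto
  also have "\<dots> = 2 * ((1 + y) ^ 4 * rate x ^ n)"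
    by (simp only: power_add[symmetric]) simp
  also have "\<dots> \<le> 2 * 80 ^ 4" using A by linarith
  finally have "(real n + 1) * (vers x)\<^sup>2 * rate x ^ n \<le> 2 * 80 ^ 4 / (real n * (1 + y)\<^sup>2)"
    using n y by (subst pos_le_divide_eq) auto
  also have "\<dots> = 2 * 80 ^ 4 / real n * (1 / (1 + y))\<^sup>2" by (simp add: power_divide)
  also have "\<dots> \<le> 2 * 80 ^ 4 / real n * (wt n x)\<^sup>2"
    using inverse_vers_le_wt[OF x, of n] y unfolding y_def
    by (intro mult_left_mono power_mono) auto
  finally show ?thesis .
qed

lemma Cauchy_Schwarz_weighted:
  fixes f w :: "real \<Rightarrow> real"
  assumes "integrable M f" "integrable M w" "integrable M (\<lambda>x. (f x)\<^sup>2 / w x)"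
    and pos: "\<And>x. w x > 0" "(LINT x|M. w x) > 0"
  shows "(LINT x|M. f x)\<^sup>2 \<le> (LINT x|M. w x) * (LINT x|M. (f x)\<^sup>2 / w x)"
proof -
  define W I J where "W = (LINT x|M. w x)" and "I = (LINT x|M. f x)" and "J = (LINT x|M. (f x)\<^sup>2 / w x)"
  \<comment> \<open>This r minimises the integral of \<open>(f x - r * w x)^2 / w x\<close>.\<close>
  define r where "r = I / W"
  have "(f x - r * w x)\<^sup>2 / w x = (f x)\<^sup>2 / w x - 2 * r * f x + r\<^sup>2 * w x" for x
    using pos(1)[of x] by (simp add: power2_eq_square field_simps)
  then have "0 \<le> (f x)\<^sup>2 / w x - 2 * r * f x + r\<^sup>2 * w x" for x
    using pos(1)[of x] by (metis divide_nonneg_pos zero_le_power2)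
  then have "0 \<le> (LINT x|M. (f x)\<^sup>2 / w x - 2 * r * f x + r\<^sup>2 * w x)"
    by (intro Bochner_Integration.integral_nonneg) auto
  also have "\<dots> = J - 2 * r * I + r\<^sup>2 * W"
    unfolding J_def I_def W_def using assms(1-3) by simp
  finally have "0 \<le> (J - 2 * r * I + r\<^sup>2 * W) * W"
    using pos(2) unfolding W_def by (intro mult_nonneg_nonneg) auto
  also have "\<dots> = W * J - I\<^sup>2"
    using pos(2) unfolding W_def[symmetric] r_def by (simp add: power2_eq_square field_simps)
  finally show ?thesis unfolding W_def I_def J_def by simp
qed

lemma avg_integral:
  assumes "\<And>t. integrable M (g t)"
  shows "avg n (\<lambda>t. LINT x|M. g t x) = (LINT x|M. avg n (\<lambda>t. g t x))"
  unfolding avg_def using assms by (simp add: Bochner_Integration.integral_sum)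

text \<open>Minkowski's inequality for the mean square over \<open>t\<close>, in the form obtained from the
  Cauchy-Schwarz inequality with weight \<open>wt n\<close>.\<close>

lemma avg_integral_sq_le:
  fixes \<phi> :: "nat \<Rightarrow> real \<Rightarrow> real"
  assumes meas: "\<And>t. \<phi> t \<in> borel_measurable borel"
    and bdd: "\<And>t. \<exists>B. \<forall>x. 0 \<le> x \<longrightarrow> x \<le> pi \<longrightarrow> \<bar>\<phi> t x\<bar> \<le> B"
    and le: "\<And>x. 0 \<le> x \<Longrightarrow> x \<le> pi \<Longrightarrow> avg n (\<lambda>t. (\<phi> t x)\<^sup>2) \<le> K * (wt n x)\<^sup>2"
    and n: "n > 0" and K: "K \<ge> 0"
  shows "avg n (\<lambda>t. (LINT x|half_circle. \<phi> t x)\<^sup>2) \<le> K * pi ^ 4 / n"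
proof -
  note [measurable] = meas
  let ?W = "LINT x|half_circle. wt n x"
  note W = integral_wt_pos_le[OF n]
  have int: "integrable half_circle (\<phi> t)" for t
    using bdd[of t] integrable_half_circle_bounded[OF meas] by blast
  have int2: "integrable half_circle (\<lambda>x. (\<phi> t x)\<^sup>2 / wt n x)" for t
  proof -
    obtain B where B: "\<And>x. 0 \<le> x \<Longrightarrow> x \<le> pi \<Longrightarrow> \<bar>\<phi> t x\<bar> \<le> B" using bdd[of t] by blast
    show ?thesis
    proof (rule integrable_half_circle_bounded)
      fix x assume x: "0 \<le> x" "x \<le> pi"
      have "2 * real n * (x / pi)\<^sup>2 \<le> 2 * real n * 1"
        using x by (intro mult_left_mono power_le_one) auto
      then have "1 / wt n x \<le> 1 + 2 * real n" by (simp add: wt_def)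
      moreover have "(\<phi> t x)\<^sup>2 \<le> B\<^sup>2" using B[OF x] by (intro abs_le_square_iff[THEN iffD1]) auto
      ultimately have "(\<phi> t x)\<^sup>2 * (1 / wt n x) \<le> B\<^sup>2 * (1 + 2 * real n)"
        using wt_pos[of n x] by (intro mult_mono) auto
      then show "\<bar>(\<phi> t x)\<^sup>2 / wt n x\<bar> \<le> B\<^sup>2 * (1 + 2 * real n)"
        using wt_pos[of n x] by simp
    qed measurable
  qed
  have "avg n (\<lambda>t. (LINT x|half_circle. \<phi> t x)\<^sup>2) \<le> avg n (\<lambda>t. ?W * (LINT x|half_circle. (\<phi> t x)\<^sup>2 / wt n x))"
    by (intro avg_mono Cauchy_Schwarz_weighted int int2 integrable_wt wt_pos W)
  also have "\<dots> = ?W * (LINT x|half_circle. avg n (\<lambda>t. (\<phi> t x)\<^sup>2 / wt n x))"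
    unfolding avg_cmult avg_integral[OF int2] ..
  also have "\<dots> \<le> ?W * (LINT x|half_circle. K * wt n x)"
  proof (intro mult_left_mono integral_half_circle_mono)
    show "integrable half_circle (\<lambda>x. avg n (\<lambda>t. (\<phi> t x)\<^sup>2 / wt n x))"
      unfolding avg_def by (intro Bochner_Integration.integrable_divide Bochner_Integration.integrable_sum int2)
    show "integrable half_circle (\<lambda>x. K * wt n x)" using integrable_wt by simp
    fix x assume x: "0 \<le> x" "x \<le> pi"
    have "avg n (\<lambda>t. (\<phi> t x)\<^sup>2 / wt n x) \<le> K * (wt n x)\<^sup>2 / wt n x"
      unfolding avg_divide using le[OF x] wt_pos[of n x] by (intro divide_right_mono) auto
    then show "avg n (\<lambda>t. (\<phi> t x)\<^sup>2 / wt n x) \<le> K * wt n x"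
      using wt_pos[of n x] by (simp add: power2_eq_square)
  qed (use W in simp)
  also have "\<dots> = K * ?W\<^sup>2" by (simp add: power2_eq_square)
  also have "\<dots> \<le> K * (pi\<^sup>2 / sqrt n)\<^sup>2" using W K by (intro mult_left_mono power_mono) auto
  also have "\<dots> = K * pi ^ 4 / n" by (simp add: power_divide)
  finally show ?thesis .
qed

text \<open>The function g of the overview. As \<open>1 - vers x / 2\<close> is the square of
  \<open>cos (x / 2)\<close>, this is a Wallis integral, equal to \<open>pi\<close> times the
  central binomial coefficient of 2n over 4^n.\<close>

definition base :: "nat \<Rightarrow> real" where
  "base n = (LINT x|half_circle. (1 - vers x / 2) ^ n)"

lemma half_vers_bounds: "0 \<le> 1 - vers x / 2" "1 - vers x / 2 \<le> 1"
  using vers_bounds[of x] by simp_all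

lemma measurable_vers [measurable]: "vers \<in> borel_measurable borel"
  unfolding vers_def[abs_def] by measurable

lemma integrable_base: "integrable half_circle (\<lambda>x. (1 - vers x / 2) ^ n)"
  by (rule integrable_half_circle_bounded[of _ 1])
    (use half_vers_bounds in \<open>auto simp: power_abs abs_of_nonneg power_le_one\<close>)

text \<open>Up to \<open>1 / sqrt n\<close> one has \<open>n * x^2 \<le> 1\<close>, and Bernoulli's
  inequality loses at most 1/4 of the integrand.\<close>

lemma base_ge:
  assumes "n > 0" shows "3 / (4 * sqrt n) \<le> base n"
proof -
  define r where "r = 1 / sqrt n"
  have r: "0 \<le> r" "r \<le> 1" using assms by (simp_all add: r_def)
  then have "r \<le> pi" using pi_gt3 by linarith
  have "3 / (4 * sqrt n) = 3/4 * measure half_circle {0..r}"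
    using r \<open>r \<le> pi\<close> by (subst measure_restrict_space) (auto simp: r_def)
  also have "\<dots> = (LINT x|half_circle. 3/4 * indicator {0..r} x)"
    using r \<open>r \<le> pi\<close> by (simp add: space_restrict_space Int_absorb1)
  also have "\<dots> \<le> (LINT x|half_circle. (1 - vers x / 2) ^ n)"
  proof (rule integral_half_circle_mono[OF _ integrable_base])
    show "integrable half_circle (\<lambda>x. 3/4 * indicator {0..r} x :: real)"
      by (rule integrable_half_circle_bounded[of _ 1]) (auto simp: indicator_def)
    fix x :: real
    show "3/4 * indicator {0..r} x \<le> (1 - vers x / 2) ^ n"
    proof (cases "x \<in> {0..r}")
      case True
      then have "x\<^sup>2 \<le> r\<^sup>2" by (intro power_mono) auto
      also have "r\<^sup>2 = 1 / n" by (simp add: r_def power_divide)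
      finally have "real n * x\<^sup>2 \<le> 1" using assms by (simp add: field_simps)
      moreover have "real n * vers x \<le> real n * (x\<^sup>2 / 2)" using vers_le[of x] by (intro mult_left_mono) auto
      ultimately have "3/4 \<le> 1 + real n * (- (vers x / 2))" by simp
      also have "\<dots> \<le> (1 + (- (vers x / 2))) ^ n"
        by (rule Bernoulli_inequality) (use half_vers_bounds[of x] in simp)
      finally show ?thesis using True by simp
    qed (use half_vers_bounds in simp)
  qed
  finally show ?thesis unfolding base_def .
qed

text \<open>This brings in \<open>\<epsilon>\<close>: for typical t, both \<open>c t\<close> and
  \<open>ct t\<close> are within \<open>base n\<close> of 1/2.\<close>

lemma base_le:
  assumes "n > 0" shows "base n \<le> 2 * pi\<^sup>2 / sqrt n"
proof -
  have "base n \<le> (LINT x|half_circle. 2 * wt n x)"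
    unfolding base_def
  proof (rule integral_half_circle_mono[OF integrable_base])
    show "integrable half_circle (\<lambda>x. 2 * wt n x)" using integrable_wt by simp
    fix x assume x: "0 \<le> x" "x \<le> pi"
    have "(1 - vers x / 2) ^ n \<le> exp (- (vers x / 2)) ^ n"
      using half_vers_bounds[of x] exp_ge_add_one_self[of "- (vers x / 2)"] by (intro power_mono) auto
    also have "\<dots> = 1 / exp (real n * vers x / 2)"
      by (simp add: exp_of_nat_mult[symmetric] exp_minus field_simps)
    also have "\<dots> \<le> 1 / ((1 + real n * vers x) / 2)"
      using exp_ge_add_one_self[of "real n * vers x / 2"] vers_bounds[of x]
      by (intro divide_left_mono) (auto intro!: add_pos_nonneg simp: field_simps)
    also have "\<dots> = 2 * (1 / (1 + real n * vers x))" by simp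
    also have "\<dots> \<le> 2 * wt n x" using inverse_vers_le_wt[OF x] by (intro mult_left_mono) auto
    finally show "(1 - vers x / 2) ^ n \<le> 2 * wt n x" .
  qed
  also have "\<dots> = 2 * (LINT x|half_circle. wt n x)" by simp
  also have "\<dots> \<le> 2 * (pi\<^sup>2 / sqrt n)" using integral_wt_pos_le(2)[OF assms] by (intro mult_left_mono) auto
  finally show ?thesis by simp
qed

text \<open>One constant for both deviations: 1000 is \<open>2 * 500\<close> from the imaginary part
  and exceeds the 32 of the real part, \<open>2 * 80 ^ 4\<close> is from
  \<open>moment_le_wt\<close>, and \<open>pi ^ 4\<close> from the squared integral of
  \<open>wt n\<close>.\<close>

definition dev_const :: real where
  "dev_const = 2000 * 80 ^ 4 * pi ^ 4"

lemma avg_diff_dev_le: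
  assumes n: "n > 0"
  shows "avg n (\<lambda>t. (pi * (c t - ct t) - base n)\<^sup>2) \<le> dev_const / (real n)\<^sup>2"
proof -
  let ?\<phi> = "\<lambda>t x. Re (gam x t) - (1 - vers x / 2) ^ n"
  have bdd: "\<exists>B. \<forall>x. 0 \<le> x \<longrightarrow> x \<le> pi \<longrightarrow> \<bar>Re (gam x t)\<bar> \<le> B" for t
  proof -
    obtain C where "\<And>k x. 0 \<le> x \<Longrightarrow> x \<le> pi \<Longrightarrow>
        \<bar>Re (gam x t * cis (- (of_int k * x)))\<bar> \<le> C * (1 + \<bar>real_of_int k\<bar>)"
      using abs_Re_gam_le[of t] by blast
    from this[of _ 0] show ?thesis by auto
  qed
  have "pi * (c t - ct t) - base n = (LINT x|half_circle. ?\<phi> t x)" for t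
  proof -
    have "integrable half_circle (\<lambda>x. Re (gam x t))" using integrable_Re_gam[of t 0] by simp
    then show ?thesis unfolding c_minus_ct base_def
      by (intro Bochner_Integration.integral_diff[symmetric] integrable_base)
  qed
  then have "avg n (\<lambda>t. (pi * (c t - ct t) - base n)\<^sup>2) = avg n (\<lambda>t. (LINT x|half_circle. ?\<phi> t x)\<^sup>2)"
    by simp
  also have "\<dots> \<le> 2000 * 80 ^ 4 / real n * pi ^ 4 / n"
  proof (rule avg_integral_sq_le[OF _ _ _ n])
    show "(\<lambda>x. ?\<phi> t x) \<in> borel_measurable borel" for t by measurable
    show "\<exists>B. \<forall>x. 0 \<le> x \<longrightarrow> x \<le> pi \<longrightarrow> \<bar>?\<phi> t x\<bar> \<le> B" for t
    proof -
      obtain B where B: "\<And>x. 0 \<le> x \<Longrightarrow> x \<le> pi \<Longrightarrow> \<bar>Re (gam x t)\<bar> \<le> B" using bdd by blast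
      have "\<bar>?\<phi> t x\<bar> \<le> B + 1" if "0 \<le> x" "x \<le> pi" for x
      proof -
        have "\<bar>(1 - vers x / 2) ^ n\<bar> \<le> 1"
          using half_vers_bounds[of x] by (simp add: power_abs power_le_one)
        with B[OF that] abs_triangle_ineq4[of "Re (gam x t)" "(1 - vers x / 2) ^ n"]
        show ?thesis by (meson add_mono order_trans)
      qed
      then show ?thesis by blast
    qed
    fix x assume x: "0 \<le> x" "x \<le> pi"
    have "avg n (\<lambda>t. (?\<phi> t x)\<^sup>2) \<le> 32 * ((real n + 1) * (vers x)\<^sup>2 * rate x ^ n)"
      using avg_Re_gam_dev_le[of n x] by (simp only: mult.assoc)
    also have "\<dots> \<le> 1000 * ((real n + 1) * (vers x)\<^sup>2 * rate x ^ n)"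
      using rate_bounds[of x] by (intro mult_right_mono mult_nonneg_nonneg) auto
    also have "\<dots> \<le> 1000 * (2 * 80 ^ 4 / real n * (wt n x)\<^sup>2)"
      by (intro mult_left_mono moment_le_wt x n) simp
    finally show "avg n (\<lambda>t. (?\<phi> t x)\<^sup>2) \<le> 2000 * 80 ^ 4 / real n * (wt n x)\<^sup>2" by simp
  qed simp
  finally show ?thesis by (simp add: dev_const_def power2_eq_square)
qed

text \<open>The third factor \<open>vers x\<close> in the bound for the imaginary part is spent
  here.\<close>

lemma vers_cot_sq_le: "vers x * (cot (x / 2))\<^sup>2 \<le> 2"
proof (cases "sin (x / 2) = 0")
  case False
  then have "vers x * (cot (x / 2))\<^sup>2 = 2 * (cos (x / 2))\<^sup>2"
    unfolding vers_half cot_def by (simp add: power_divide)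
  also have "\<dots> \<le> 2 * 1" by (intro mult_left_mono) (auto simp: abs_square_le_1)
  finally show ?thesis by simp
qed (simp add: cot_def)

lemma avg_sum_dev_le:
  assumes n: "n > 0"
  shows "avg n (\<lambda>t. (pi * (c t + ct t - 1))\<^sup>2) \<le> dev_const / (real n)\<^sup>2"
proof -
  let ?\<phi> = "\<lambda>t x. Im (gam x t) * cot (x / 2)"
  have "avg n (\<lambda>t. (pi * (c t + ct t - 1))\<^sup>2) = avg n (\<lambda>t. (LINT x|half_circle. ?\<phi> t x)\<^sup>2)"
    by (simp only: c_plus_ct)
  also have "\<dots> \<le> 2000 * 80 ^ 4 / real n * pi ^ 4 / n"
  proof (rule avg_integral_sq_le[OF _ _ _ n])
    show "(\<lambda>x. ?\<phi> t x) \<in> borel_measurable borel" for t by measurable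
    show "\<exists>B. \<forall>x. 0 \<le> x \<longrightarrow> x \<le> pi \<longrightarrow> \<bar>?\<phi> t x\<bar> \<le> B" for t
    proof -
      obtain C where "\<And>k x. 0 \<le> x \<Longrightarrow> x \<le> pi \<Longrightarrow>
          \<bar>Im (gam x t * cis (- (of_int k * x))) * cot (x / 2)\<bar> \<le> C * (1 + \<bar>real_of_int k\<bar>)"
        using abs_Im_gam_cot_le[of t] by blast
      from this[of _ 0] show ?thesis by auto
    qed
    fix x assume x: "0 \<le> x" "x \<le> pi"
    have "avg n (\<lambda>t. (?\<phi> t x)\<^sup>2) = (cot (x / 2))\<^sup>2 * avg n (\<lambda>t. (Im (gam x t))\<^sup>2)"
      unfolding avg_cmult[symmetric] by (simp add: power_mult_distrib mult.commute)
    also have "\<dots> \<le> (cot (x / 2))\<^sup>2 * (500 * (real n + 1) * vers x ^ 3 * rate x ^ n)"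
      using x by (intro mult_left_mono avg_Im_gam_sq_le sin_ge_zero) auto
    also have "\<dots> = (vers x * (cot (x / 2))\<^sup>2) * (500 * ((real n + 1) * (vers x)\<^sup>2 * rate x ^ n))"
      by (simp only: power3_eq_cube power2_eq_square mult_ac)
    also have "\<dots> \<le> 2 * (500 * ((real n + 1) * (vers x)\<^sup>2 * rate x ^ n))"
      using rate_bounds[of x] by (intro mult_right_mono vers_cot_sq_le mult_nonneg_nonneg) auto
    also have "\<dots> = 1000 * ((real n + 1) * (vers x)\<^sup>2 * rate x ^ n)" by simp
    also have "\<dots> \<le> 1000 * (2 * 80 ^ 4 / real n * (wt n x)\<^sup>2)"
      by (intro mult_left_mono moment_le_wt x n) simp
    finally show "avg n (\<lambda>t. (?\<phi> t x)\<^sup>2) \<le> 2000 * 80 ^ 4 / real n * (wt n x)\<^sup>2" by simp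
  qed simp
  finally show ?thesis by (simp add: dev_const_def power2_eq_square)
qed

section \<open>Exceptional sets and counting\<close>

lemma Chebyshev_avg:
  assumes "a > 0"
  shows "real (card {t. t < 2 ^ n \<and> a \<le> \<bar>f t\<bar>}) \<le> 2 ^ n * avg n (\<lambda>t. (f t)\<^sup>2) / a\<^sup>2"
proof -
  let ?B = "{t. t < 2 ^ n \<and> a \<le> \<bar>f t\<bar>}"
  have "real (card ?B) * a\<^sup>2 = (\<Sum>t\<in>?B. a\<^sup>2)" by simp
  also have "\<dots> \<le> (\<Sum>t\<in>?B. (f t)\<^sup>2)"
    using assms by (intro sum_mono) (auto simp: abs_le_square_iff[symmetric])
  also have "\<dots> \<le> (\<Sum>t<2 ^ n. (f t)\<^sup>2)" by (rule sum_mono2) auto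
  also have "\<dots> = 2 ^ n * avg n (\<lambda>t. (f t)\<^sup>2)" by (simp add: avg_def)
  finally show ?thesis using assms by (simp add: pos_le_divide_eq)
qed

definition typical :: "real \<Rightarrow> nat \<Rightarrow> bool" where
  "typical \<epsilon> t \<longleftrightarrow> 1/2 - \<epsilon> < ct t \<and> ct t < 1/2 \<and> 1/2 < c t \<and> c t < 1/2 + \<epsilon>"

text \<open>Sum and difference of \<open>pi * (c t - 1/2)\<close> and
  \<open>pi * (1/2 - ct t)\<close> are known up to \<open>b / 4\<close>, which places both numbers
  between \<open>b / 4\<close> and \<open>3 * b / 4\<close>.\<close>

lemma typicalI:
  assumes dif: "\<bar>pi * (c t - ct t) - b\<bar> < b / 4" and sum: "\<bar>pi * (c t + ct t - 1)\<bar> < b / 4" and "b < \<epsilon>"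
  shows "typical \<epsilon> t"
proof -
  define p q where "p = c t - 1/2" and "q = 1/2 - ct t"
  have "pi * (c t - ct t) = pi * p + pi * q" "pi * (c t + ct t - 1) = pi * p - pi * q"
    by (simp_all add: p_def q_def algebra_simps)
  with dif sum have "0 < pi * p" "0 < pi * q" "pi * p < b" "pi * q < b" by linarith+
  then have pos: "0 < p" "0 < q" by (simp_all add: zero_less_mult_iff)
  have "1 * p \<le> pi * p" "1 * q \<le> pi * q"
    using pos pi_gt3 by (intro mult_right_mono; simp)+
  with \<open>pi * p < b\<close> \<open>pi * q < b\<close> \<open>b < \<epsilon>\<close> have "p < \<epsilon>" "q < \<epsilon>" by linarith+
  with pos show ?thesis by (simp add: typical_def p_def q_def)
qed

lemma card_atypical_le:
  assumes "\<epsilon> > 0"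
  shows "\<exists>K>0. \<exists>n0. \<forall>n\<ge>n0. real (card {t. t < 2 ^ n \<and> \<not> typical \<epsilon> t}) \<le> K * 2 ^ n / real n"
proof -
  have "(\<lambda>n. 2 * pi\<^sup>2 / sqrt (real n)) \<longlonglongrightarrow> 0"
    by real_asymp
  then have "\<forall>\<^sub>F n in sequentially. 2 * pi\<^sup>2 / sqrt (real n) < \<epsilon>"
    using assms by (rule order_tendstoD)
  then obtain m where m: "\<And>n. n \<ge> m \<Longrightarrow> 2 * pi\<^sup>2 / sqrt (real n) < \<epsilon>"
    unfolding eventually_sequentially by blast
  have "real (card {t. t < 2 ^ n \<and> \<not> typical \<epsilon> t}) \<le> (2 * dev_const * (256 / 9)) * 2 ^ n / real n"
    if n: "n \<ge> max 1 m" for n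
  proof -
    have n0: "n > 0" using n by simp
    \<comment> \<open>A quarter of the lower bound for \<open>base n\<close>. Its square is of order
      1/n, against mean squares of order 1/n^2.\<close>
    define a where "a = 3 / (16 * sqrt n)"
    have a: "a > 0" "a\<^sup>2 = 9 / (256 * real n)" using n0 by (simp_all add: a_def power_divide power_mult_distrib)
    have ab: "a \<le> base n / 4" using base_ge[OF n0] by (simp add: a_def)
    have "base n < \<epsilon>" using base_le[OF n0] m[of n] n by simp
    let ?A = "{t. t < 2 ^ n \<and> a \<le> \<bar>pi * (c t - ct t) - base n\<bar>}"
    let ?B = "{t. t < 2 ^ n \<and> a \<le> \<bar>pi * (c t + ct t - 1)\<bar>}"
    have "{t. t < 2 ^ n \<and> \<not> typical \<epsilon> t} \<subseteq> ?A \<union> ?B"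
    proof
      fix t assume t: "t \<in> {t. t < 2 ^ n \<and> \<not> typical \<epsilon> t}"
      then have "\<not> (\<bar>pi * (c t - ct t) - base n\<bar> < base n / 4 \<and> \<bar>pi * (c t + ct t - 1)\<bar> < base n / 4)"
        using typicalI[OF _ _ \<open>base n < \<epsilon>\<close>] by blast
      then have "a \<le> \<bar>pi * (c t - ct t) - base n\<bar> \<or> a \<le> \<bar>pi * (c t + ct t - 1)\<bar>"
        using ab by (meson not_le order_less_le_trans)
      then show "t \<in> ?A \<union> ?B" using t by blast
    qed
    then have "card {t. t < 2 ^ n \<and> \<not> typical \<epsilon> t} \<le> card (?A \<union> ?B)"
      by (rule card_mono[rotated]) auto
    also have "\<dots> \<le> card ?A + card ?B" by (rule card_Un_le)
    finally have "real (card {t. t < 2 ^ n \<and> \<not> typical \<epsilon> t}) \<le> real (card ?A) + real (card ?B)" by simp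
    also have "\<dots> \<le> 2 ^ n * (dev_const / (real n)\<^sup>2) / a\<^sup>2 + 2 ^ n * (dev_const / (real n)\<^sup>2) / a\<^sup>2"
    proof (rule add_mono)
      show "real (card ?A) \<le> 2 ^ n * (dev_const / (real n)\<^sup>2) / a\<^sup>2"
        by (rule order_trans[OF Chebyshev_avg[OF a(1)]])
          (intro divide_right_mono mult_left_mono avg_diff_dev_le n0; simp)
      show "real (card ?B) \<le> 2 ^ n * (dev_const / (real n)\<^sup>2) / a\<^sup>2"
        by (rule order_trans[OF Chebyshev_avg[OF a(1)]])
          (intro divide_right_mono mult_left_mono avg_sum_dev_le n0; simp)
    qed
    also have "\<dots> = (2 * dev_const * (256 / 9)) * 2 ^ n / real n"
      unfolding a(2) using n0 by (simp add: power2_eq_square field_simps)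
    finally show ?thesis .
  qed
  moreover have "2 * dev_const * (256 / 9) > 0" by (simp add: dev_const_def)
  ultimately show ?thesis by blast
qed

text \<open>Passing to the next power of two at most doubles the range, and its exponent is at least
  \<open>ln N\<close>.\<close>

lemma card_atypical_le_ln:
  assumes "\<epsilon> > 0"
  shows "\<exists>K>0. \<exists>N0. \<forall>N\<ge>N0. real (card {t. t < N \<and> \<not> typical \<epsilon> t}) \<le> K * real N / ln (real N)"
proof -
  obtain K n0 where K: "K > 0"
    "\<And>n. n \<ge> n0 \<Longrightarrow> real (card {t. t < 2 ^ n \<and> \<not> typical \<epsilon> t}) \<le> K * 2 ^ n / real n"
    using card_atypical_le[OF assms] by blast
  have "real (card {t. t < N \<and> \<not> typical \<epsilon> t}) \<le> (2 * K) * real N / ln (real N)"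
    if N: "N \<ge> max 2 (2 ^ n0)" for N
  proof -
    have N2: "N \<ge> 2" "N \<ge> 2 ^ n0" using N by simp_all
    obtain n where n: "2 ^ n \<le> N" "N < 2 ^ (n + 1)"
      using ex_power_ivl1[of 2 N] N2 by auto
    have "(2::nat) ^ n0 < 2 ^ (n + 1)" using n N2 by linarith
    then have "n + 1 \<ge> n0" using power_less_imp_less_exp[of "2 :: nat" n0 "n + 1"] by simp
    have "card {t. t < N \<and> \<not> typical \<epsilon> t} \<le> card {t. t < 2 ^ (n + 1) \<and> \<not> typical \<epsilon> t}"
      using n by (intro card_mono) auto
    then have "real (card {t. t < N \<and> \<not> typical \<epsilon> t}) \<le> K * 2 ^ (n + 1) / real (n + 1)"
      using K(2)[OF \<open>n + 1 \<ge> n0\<close>] by linarith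
    also have "\<dots> \<le> K * (2 * real N) / real (n + 1)"
    proof (intro divide_right_mono mult_left_mono)
      have "(2::real) ^ n \<le> real N" using n(1) by (metis of_nat_le_iff of_nat_numeral of_nat_power)
      then show "(2::real) ^ (n + 1) \<le> 2 * real N" by simp
    qed (use K in auto)
    also have "\<dots> \<le> K * (2 * real N) / ln (real N)"
    proof (rule divide_left_mono)
      have "real N < 2 ^ (n + 1)" using n(2) by (metis of_nat_less_iff of_nat_numeral of_nat_power)
      then have "ln (real N) \<le> ln (2 ^ (n + 1))" using N2 by (subst ln_le_cancel_iff) auto
      also have "\<dots> = real (n + 1) * ln 2" by (rule ln_realpow)
      also have "\<dots> \<le> real (n + 1) * 1" using ln_2_less_1 by (intro mult_left_mono) auto
      finally show "ln (real N) \<le> real (n + 1)" by simp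
    qed (use K N2 in auto)
    finally show ?thesis by (simp only: mult_ac)
  qed
  moreover have "2 * K > 0" using K by simp
  ultimately show ?thesis by blast
qed

lemma card_typical: "real (card {t. t < N \<and> typical \<epsilon> t}) = real N - real (card {t. t < N \<and> \<not> typical \<epsilon> t})"
proof -
  have "card {t. t < N \<and> typical \<epsilon> t} + card {t. t < N \<and> \<not> typical \<epsilon> t}
      = card ({t. t < N \<and> typical \<epsilon> t} \<union> {t. t < N \<and> \<not> typical \<epsilon> t})"
    by (rule card_Un_disjoint[symmetric]) auto
  also have "{t. t < N \<and> typical \<epsilon> t} \<union> {t. t < N \<and> \<not> typical \<epsilon> t} = {..<N}" by auto
  finally have "card {t. t < N \<and> typical \<epsilon> t} + card {t. t < N \<and> \<not> typical \<epsilon> t} = N" by simp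
  then show ?thesis by linarith
qed

lemma typical_count_bigo:
  assumes "\<epsilon> > 0"
  shows "(\<lambda>T. real (card {t. t \<le> T \<and> typical \<epsilon> t}) - real T) \<in> O(\<lambda>T. real T / ln (real T))"
proof -
  obtain K N0 where K: "K > 0"
    "\<And>N. N \<ge> N0 \<Longrightarrow> real (card {t. t < N \<and> \<not> typical \<epsilon> t}) \<le> K * real N / ln (real N)"
    using card_atypical_le_ln[OF assms] by blast
  show ?thesis
  proof (rule bigoI)
    show "\<forall>\<^sub>F T in sequentially. norm (real (card {t. t \<le> T \<and> typical \<epsilon> t}) - real T)
        \<le> (2 * K + 1) * norm (real T / ln (real T))"
      using eventually_ge_at_top[of "max 2 N0"]
    proof eventually_elim
      case (elim T)
      let ?b = "real (card {t. t < T + 1 \<and> \<not> typical \<epsilon> t})"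
      have T: "T \<ge> 2" "T + 1 \<ge> N0" using elim by simp_all
      have ln: "0 < ln (real T)" "ln (real T) \<le> real T" "ln (real T) \<le> ln (real (T + 1))"
        using T ln_less_self[of "real T", THEN less_imp_le] by simp_all
      have "{t. t \<le> T \<and> typical \<epsilon> t} = {t. t < T + 1 \<and> typical \<epsilon> t}" by auto
      \<comment> \<open>There are \<open>T + 1\<close> values of t up to T; the surplus 1 is
        absorbed below by \<open>T / ln T \<ge> 1\<close>.\<close>
      then have "real (card {t. t \<le> T \<and> typical \<epsilon> t}) - real T = 1 - ?b"
        using card_typical[of "T + 1" \<epsilon>] by simp
      then have "norm (real (card {t. t \<le> T \<and> typical \<epsilon> t}) - real T) \<le> 1 + ?b" by simp
      also have "?b \<le> K * real (T + 1) / ln (real (T + 1))" by (rule K(2)[OF T(2)])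
      also have "\<dots> \<le> K * (2 * real T) / ln (real T)"
        using K T ln by (intro frac_le mult_left_mono mult_nonneg_nonneg) auto
      also have "1 \<le> real T / ln (real T)" using ln by simp
      finally show ?case using ln by (simp add: algebra_simps add_divide_distrib)
    qed
  qed
qed

lemma typical_density:
  assumes "\<epsilon> > 0"
  shows "(\<lambda>N. real (card {t. t < N \<and> typical \<epsilon> t}) / real N) \<longlonglongrightarrow> 1"
proof -
  obtain K N0 where K: "K > 0"
    "\<And>N. N \<ge> N0 \<Longrightarrow> real (card {t. t < N \<and> \<not> typical \<epsilon> t}) \<le> K * real N / ln (real N)"
    using card_atypical_le_ln[OF assms] by blast
  have "(\<lambda>N. 1 - K / ln (real N)) \<longlonglongrightarrow> 1" by real_asymp
  moreover have "\<forall>\<^sub>F N in sequentially. 1 - K / ln (real N) \<le> real (card {t. t < N \<and> typical \<epsilon> t}) / real N"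
    using eventually_ge_at_top[of "max 2 N0"]
  proof eventually_elim
    case (elim N)
    then have N: "N > 0" "N \<ge> N0" by simp_all
    have "real (card {t. t < N \<and> \<not> typical \<epsilon> t}) / real N \<le> (K * real N / ln (real N)) / real N"
      by (intro divide_right_mono K N) simp
    also have "\<dots> = K / ln (real N)" using N by simp
    finally show ?case unfolding card_typical diff_divide_distrib using N by simp
  qed
  moreover have "\<forall>\<^sub>F N in sequentially. real (card {t. t < N \<and> typical \<epsilon> t}) / real N \<le> 1"
    using eventually_gt_at_top[of 0] by eventually_elim (simp add: card_typical)
  ultimately show ?thesis by (rule tendsto_sandwich[OF _ _ _ tendsto_const, rotated 2])
qed

theorem theorem1p1:
  shows "(\<forall>\<epsilon>::real. \<epsilon> > 0 \<longrightarrow>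
           (\<lambda>T::nat. real (card {t. t \<le> T \<and> 1/2 - \<epsilon> < ct t \<and> ct t < 1/2
                                   \<and> 1/2 < c t \<and> c t < 1/2 + \<epsilon>}) - real T)
           \<in> O(\<lambda>T. real T / ln (real T)))
       \<and> (\<lambda>N. real (card {t. t < N \<and> ct t < 1/2 \<and> 1/2 < c t}) / real N) \<longlonglongrightarrow> 1"
proof (intro conjI allI impI)
  fix \<epsilon> :: real assume "\<epsilon> > 0"
  then show "(\<lambda>T::nat. real (card {t. t \<le> T \<and> 1/2 - \<epsilon> < ct t \<and> ct t < 1/2
      \<and> 1/2 < c t \<and> c t < 1/2 + \<epsilon>}) - real T) \<in> O(\<lambda>T. real T / ln (real T))"
    using typical_count_bigo unfolding typical_def by blast
next
  have "0 \<le> ct t" "c t \<le> 1" for t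
    unfolding c_eq_gain_tail ct_eq_gain_tail by (rule gain_tail_bounds)+
  then have "-1 < ct t" "c t < 2" for t
    by (metis less_minus_one_simps(1) order_less_le_trans, metis one_less_numeral_iff order_le_less_trans semiring_norm(76))
  \<comment> \<open>With \<open>\<epsilon> = 3/2\<close> the outer bounds become
    \<open>-1 < ct t\<close> and \<open>c t < 2\<close>, which hold for every t.\<close>
  then have "typical (3/2) t \<longleftrightarrow> ct t < 1/2 \<and> 1/2 < c t" for t
    unfolding typical_def by simp
  then show "(\<lambda>N. real (card {t. t < N \<and> ct t < 1/2 \<and> 1/2 < c t}) / real N) \<longlonglongrightarrow> 1"
    using typical_density[of "3/2"] by simp
qed

end
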